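(* Let $\theta$ be an inner function with $0$-th Fourier coefficient $\theta_0$, let $\phi\in L^\infty$, and let $A$ be a bounded linear operator on $K_\theta^\perp$ satisfying $$A-U_\theta AU_\theta=\theta\otimes\left(Q_\theta J(\alpha_{\phi^*})-\langle Q_\theta J(\alpha_{\phi^*}),\bar z\rangle\bar z\right)+\left(Q_\theta J\left(\phi\bar z(1-\bar\theta_0\theta)\right)+\delta\theta\right)\otimes\bar z,$$ where $\alpha_\phi=\phi(\theta-\theta_0)$ (so $\alpha_{\phi^*}=\phi^*(\theta-\theta_0)$) and $\delta=\bar\theta_0\langle\phi\theta(\theta^*-\bar\theta_0),z\rangle$. Then: (a) if $\theta_0\neq0$, then $A=\mathcal{H}_\phi^\theta$ if and only if $A\theta=\mathcal{H}_\phi^\theta\theta$; (b) if $\theta_0=0$, then $A=\mathcal{H}_\phi^\theta$ if and only if $A\theta=\mathcal{H}_\phi^\theta\theta$ and $A^*\bar z=(\mathcal{H}_\phi^\theta)^*\bar z$.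
   Context: $\mathbb{T}$ is the unit circle with normalized Lebesgue measure, $L^2=L^2(\mathbb{T})$ with inner product $\langle\cdot,\cdot\rangle$ linear in the first entry, $L^\infty=L^\infty(\mathbb{T})$. $H^2\subset L^2$ is the Hardy space (functions whose negative Fourier coefficients vanish), $H_0^2=zH^2$, $\overline{H_0^2}=L^2\ominus H^2$. $P:L^2\to H^2$ is the orthogonal projection and $Q=I-P$ is the orthogonal projection onto $\overline{H_0^2}$. The flip $J$ on $L^2$ is $(Jf)(z)=f(\bar z)$, $z\in\mathbb{T}$. For an inner function $\theta$ (bounded analytic on the disk, unimodular a.e. on $\mathbb{T}$), $K_\theta=H^2\ominus\theta H^2$ and $K_\theta^\perp=L^2\ominus K_\theta=\overline{H_0^2}\oplus\theta H^2$; $Q_\theta=Q+\theta P\bar\theta$ is the orthogonal projection of $L^2$ onto $K_\theta^\perp$. For $\phi\in L^\infty$ the dual truncated Hankel operator is $\mathcal{H}_\phi^\theta:K_\theta^\perp\to K_\theta^\perp$, $\mathcal{H}_\phi^\theta(h)=Q_\theta J(\phi h)$. The compressed shift on $K_\theta^\perp$ is $U_\theta h=Q_\theta(zh)$. For $f,g$ in a Hilbert space, $f\otimes g$ is the operator $h\mapsto\langle h,g\rangle f$. For $\phi\in L^2$, $\phi^*(z)=\overline{\phi(\bar z)}$ on $\mathbb{T}$. *)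

theory Defs
  imports "HOL-Analysis.Analysis"
begin

section \<open>Normalized Lebesgue measure on the unit circle\<close>

definition circle :: "complex measure" where
  "circle = distr (uniform_measure lborel {-pi..pi}) (restrict_space borel (sphere 0 1)) cis"

lemma space_circle [simp]: "space circle = sphere 0 1"
  by (simp add: circle_def space_restrict_space)

lemma sets_circle [measurable_cong]: "sets circle = sets (restrict_space borel (sphere 0 1))"
  by (simp add: circle_def)

lemma measurable_cis_sphere:
  "cis \<in> measurable borel (restrict_space borel (sphere 0 1))"
  by (intro measurable_restrict_space2 borel_measurable_continuous_onI continuous_intros) auto

lemma measurable_cnj_circle [measurable]: "cnj \<in> measurable circle circle"
proof -
  have "cnj \<in> measurable (restrict_space borel (sphere 0 1)) (restrict_space borel (sphere 0 1))"
    by (intro measurable_restrict_space3 borel_measurable_continuous_onI continuous_intros) auto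
  then show ?thesis
    by (simp add: measurable_cong_sets[OF sets_circle sets_circle])
qed

lemma distr_uniform_uminus:
  "distr (uniform_measure lborel {-pi..pi}) borel uminus = uniform_measure lborel {-pi..pi}"
proof (rule measure_eqI)
  fix X :: "real set"
  assume "X \<in> sets (distr (uniform_measure lborel {-pi..pi}) borel uminus)"
  then have X [measurable]: "X \<in> sets borel" by simp
  have um: "(uminus :: real \<Rightarrow> real) \<in> measurable borel borel" by simp
  have V: "uminus -` X \<in> sets (borel :: real measure)"
    using measurable_sets[OF um X] by simp
  have "emeasure lborel ({-pi..pi} \<inter> X) = emeasure (distr lborel borel uminus) ({-pi..pi} \<inter> X)"
    by (simp add: lborel_distr_uminus)
  also have "\<dots> = emeasure lborel (uminus -` ({-pi..pi} \<inter> X))"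
    by (subst emeasure_distr) auto
  also have "uminus -` ({-pi..pi} \<inter> X) = {-pi..pi} \<inter> uminus -` X" by auto
  finally have eq: "emeasure lborel ({-pi..pi} \<inter> X) = emeasure lborel ({-pi..pi} \<inter> uminus -` X)" .
  have "emeasure (distr (uniform_measure lborel {-pi..pi}) borel uminus) X
      = emeasure (uniform_measure lborel {-pi..pi}) (uminus -` X)"
    by (subst emeasure_distr) simp_all
  also have "\<dots> = emeasure (uniform_measure lborel {-pi..pi}) X"
    using V X eq by simp
  finally show "emeasure (distr (uniform_measure lborel {-pi..pi}) borel uminus) X
      = emeasure (uniform_measure lborel {-pi..pi}) X" .
qed simp

lemma distr_circle_cnj: "distr circle circle cnj = circle"
proof -
  let ?U = "uniform_measure lborel {-pi..pi} :: real measure"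
  let ?S = "restrict_space borel (sphere 0 1) :: complex measure"
  have c: "cis \<in> measurable ?U ?S"
    using measurable_cis_sphere by (simp add: measurable_cong_sets[of ?U borel])
  have "distr circle circle cnj = distr (distr ?U ?S cis) ?S cnj"
    unfolding circle_def by (rule distr_cong) auto
  also have "\<dots> = distr ?U ?S (cnj \<circ> cis)"
    using measurable_cnj_circle c
    by (intro distr_distr) (simp_all add: measurable_cong_sets[OF sets_circle sets_circle])
  also have "cnj \<circ> cis = cis \<circ> uminus"
    by (auto simp: cis_cnj)
  also have "distr ?U ?S (cis \<circ> uminus) = distr (distr ?U borel uminus) ?S cis"
    using measurable_cis_sphere by (intro distr_distr[symmetric]) auto
  also have "\<dots> = circle"
    by (simp add: distr_uniform_uminus circle_def)
  finally show ?thesis .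
qed


section \<open>The space \<open>L\<^sup>2\<close> of the circle\<close>

definition square_integrable :: "(complex \<Rightarrow> complex) \<Rightarrow> bool" where
  "square_integrable f \<longleftrightarrow>
     f \<in> borel_measurable circle \<and> integrable circle (\<lambda>z. (norm (f z))\<^sup>2)"

definition L2_rel :: "(complex \<Rightarrow> complex) \<Rightarrow> (complex \<Rightarrow> complex) \<Rightarrow> bool" where
  "L2_rel f g \<longleftrightarrow> square_integrable f \<and> square_integrable g \<and> (AE z in circle. f z = g z)"

lemma square_integrable_zero [simp]: "square_integrable (\<lambda>_. 0)"
  by (simp add: square_integrable_def)

lemma square_integrable_add:
  assumes "square_integrable f" "square_integrable g"
  shows "square_integrable (\<lambda>z. f z + g z)"
proof -
  have [measurable]: "f \<in> borel_measurable circle" "g \<in> borel_measurable circle"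
    using assms by (auto simp: square_integrable_def)
  have "(norm (f z + g z))\<^sup>2 \<le> 2 * (norm (f z))\<^sup>2 + 2 * (norm (g z))\<^sup>2" for z
  proof -
    have "(norm (f z + g z))\<^sup>2 \<le> (norm (f z) + norm (g z))\<^sup>2"
      by (intro power_mono norm_triangle_ineq) auto
    also have "\<dots> \<le> 2 * (norm (f z))\<^sup>2 + 2 * (norm (g z))\<^sup>2"
      using sum_squares_ge_zero[of "norm (f z) - norm (g z)" 0]
      by (simp add: power2_eq_square algebra_simps)
    finally show ?thesis .
  qed
  moreover have "integrable circle (\<lambda>z. 2 * (norm (f z))\<^sup>2 + 2 * (norm (g z))\<^sup>2)"
    using assms by (auto simp: square_integrable_def)
  ultimately have "integrable circle (\<lambda>z. (norm (f z + g z))\<^sup>2)"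
    by (rule_tac Bochner_Integration.integrable_bound) auto
  then show ?thesis
    by (simp add: square_integrable_def)
qed

definition Linf :: "(complex \<Rightarrow> complex) set" where
  "Linf = {\<phi> \<in> borel_measurable circle. \<exists>C. AE z in circle. norm (\<phi> z) \<le> C}"

lemma square_integrable_mult:
  assumes "\<phi> \<in> Linf" "square_integrable f"
  shows "square_integrable (\<lambda>z. \<phi> z * f z)"
proof -
  have [measurable]: "f \<in> borel_measurable circle" "\<phi> \<in> borel_measurable circle"
    using assms by (auto simp: square_integrable_def Linf_def)
  obtain C where C: "AE z in circle. norm (\<phi> z) \<le> C"
    using assms by (auto simp: Linf_def)
  have "AE z in circle. norm ((norm (\<phi> z * f z))\<^sup>2) \<le> norm (C\<^sup>2 * (norm (f z))\<^sup>2)"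
    using C
  proof eventually_elim
    case (elim z)
    then have "(norm (\<phi> z))\<^sup>2 \<le> C\<^sup>2" by (intro power_mono) auto
    then show ?case by (auto simp: norm_mult power_mult_distrib intro!: mult_right_mono)
  qed
  moreover have "integrable circle (\<lambda>z. C\<^sup>2 * (norm (f z))\<^sup>2)"
    using assms by (auto simp: square_integrable_def)
  ultimately have "integrable circle (\<lambda>z. (norm (\<phi> z * f z))\<^sup>2)"
    by (rule_tac Bochner_Integration.integrable_bound[where f = "\<lambda>z. C\<^sup>2 * (norm (f z))\<^sup>2"]) simp_all
  then show ?thesis
    by (simp add: square_integrable_def)
qed

lemma square_integrable_scale:
  "square_integrable f \<Longrightarrow> square_integrable (\<lambda>z. c * f z)"
  by (rule square_integrable_mult[of "\<lambda>_. c"]) (auto simp: Linf_def)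

lemma square_integrable_cnj_arg:
  assumes "square_integrable f"
  shows "square_integrable (\<lambda>z. f (cnj z))"
proof -
  have [measurable]: "f \<in> borel_measurable circle"
    using assms by (auto simp: square_integrable_def)
  have "integrable (distr circle circle cnj) (\<lambda>z. (norm (f z))\<^sup>2)"
    using assms by (simp add: distr_circle_cnj square_integrable_def)
  then have "integrable circle (\<lambda>z. (norm (f (cnj z)))\<^sup>2)"
    by (rule integrable_distr[OF measurable_cnj_circle])
  then show ?thesis by (simp add: square_integrable_def)
qed

lemma AE_circle_cnj:
  assumes "AE z in circle. P z"
  shows "AE z in circle. P (cnj z)"
proof -
  have "AE z in distr circle circle cnj. P z"
    unfolding distr_circle_cnj by (rule assms)
  then show ?thesis
    by (rule AE_distrD[OF measurable_cnj_circle])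
qed

lemma integrable_mult_cnj:
  assumes "square_integrable f" "square_integrable g"
  shows "integrable circle (\<lambda>z. f z * cnj (g z))"
proof -
  have [measurable]: "f \<in> borel_measurable circle" "g \<in> borel_measurable circle"
    using assms by (auto simp: square_integrable_def)
  have "cnj \<in> borel_measurable borel"
    by (intro borel_measurable_continuous_onI continuous_intros)
  then have [measurable]: "(\<lambda>z. cnj (g z)) \<in> borel_measurable circle"
    by (rule measurable_compose[rotated]) measurable
  have m: "(\<lambda>z. f z * cnj (g z)) \<in> borel_measurable circle"
    by measurable
  have "norm (f z * cnj (g z)) \<le> (norm (f z))\<^sup>2 + (norm (g z))\<^sup>2" for z
  proof -
    have "2 * (norm (f z) * norm (g z)) \<le> (norm (f z))\<^sup>2 + (norm (g z))\<^sup>2"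
      using sum_squares_ge_zero[of "norm (f z) - norm (g z)" 0]
      by (simp add: power2_eq_square algebra_simps)
    moreover have "0 \<le> norm (f z) * norm (g z)" by simp
    ultimately show ?thesis unfolding norm_mult complex_mod_cnj by linarith
  qed
  moreover have "integrable circle (\<lambda>z. (norm (f z))\<^sup>2 + (norm (g z))\<^sup>2)"
    using assms by (auto simp: square_integrable_def)
  ultimately show ?thesis
    by (rule_tac Bochner_Integration.integrable_bound[OF _ m]) auto
qed

quotient_type L2 = "complex \<Rightarrow> complex" / partial: L2_rel
proof (rule part_equivpI)
  show "\<exists>f. L2_rel f f"
    by (rule exI[of _ "\<lambda>_. 0"]) (simp add: L2_rel_def)
  show "symp L2_rel"
    by (auto simp: L2_rel_def symp_def)
  show "transp L2_rel"
    unfolding transp_def L2_rel_def by (auto elim: AE_mp)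
qed

text \<open>The class of a function; functions that are not square integrable are sent to 0.\<close>

lift_definition class_L2 :: "(complex \<Rightarrow> complex) \<Rightarrow> L2"
  is "\<lambda>f. if square_integrable f then f else (\<lambda>_. 0)"
  by (auto simp: L2_rel_def)

instantiation L2 :: ab_group_add
begin

lift_definition zero_L2 :: L2 is "\<lambda>_. 0"
  by (simp add: L2_rel_def)

lift_definition plus_L2 :: "L2 \<Rightarrow> L2 \<Rightarrow> L2" is "\<lambda>f g z. f z + g z"
  by (auto simp: L2_rel_def square_integrable_add)

lift_definition uminus_L2 :: "L2 \<Rightarrow> L2" is "\<lambda>f z. - f z"
  by (auto simp: L2_rel_def dest: square_integrable_scale[where c = "-1"])

definition minus_L2 :: "L2 \<Rightarrow> L2 \<Rightarrow> L2" where
  "minus_L2 f g = f + - g"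

instance
proof
  fix a b c :: L2
  show "a + b + c = a + (b + c)"
    by transfer (auto simp: L2_rel_def add.assoc intro!: square_integrable_add)
  show "a + b = b + a"
    by transfer (auto simp: L2_rel_def add.commute intro!: square_integrable_add)
  show "0 + a = a"
    by transfer (auto simp: L2_rel_def)
  show "- a + a = 0"
    by transfer (auto simp: L2_rel_def)
  show "a - b = a + - b"
    by (rule minus_L2_def)
qed

end

lift_definition scaleC :: "complex \<Rightarrow> L2 \<Rightarrow> L2" (infixr "*\<^sub>C" 75) is "\<lambda>c f z. c * f z"
  by (auto simp: L2_rel_def square_integrable_scale)

lift_definition cinner :: "L2 \<Rightarrow> L2 \<Rightarrow> complex"
  is "\<lambda>f g. integral\<^sup>L circle (\<lambda>z. f z * cnj (g z))"
proof -
  fix f f' g g' :: "complex \<Rightarrow> complex"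
  assume *: "L2_rel f f'" "L2_rel g g'"
  then have "integrable circle (\<lambda>z. f z * cnj (g z))" "integrable circle (\<lambda>z. f' z * cnj (g' z))"
    by (auto simp: L2_rel_def intro: integrable_mult_cnj)
  moreover have "AE z in circle. f z * cnj (g z) = f' z * cnj (g' z)"
    using * by (auto simp: L2_rel_def)
  ultimately show "integral\<^sup>L circle (\<lambda>z. f z * cnj (g z)) = integral\<^sup>L circle (\<lambda>z. f' z * cnj (g' z))"
    by (intro integral_cong_AE) auto
qed

lemma cinner_add_left: "cinner (f + g) h = cinner f h + cinner g h"
proof transfer
  fix f g h :: "complex \<Rightarrow> complex"
  assume "L2_rel f f" "L2_rel g g" "L2_rel h h"
  then show "integral\<^sup>L circle (\<lambda>z. (f z + g z) * cnj (h z)) =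
      integral\<^sup>L circle (\<lambda>z. f z * cnj (h z)) + integral\<^sup>L circle (\<lambda>z. g z * cnj (h z))"
    by (simp add: L2_rel_def integrable_mult_cnj distrib_right)
qed

lemma cinner_scaleC_left: "cinner (c *\<^sub>C f) g = c * cinner f g"
  by transfer (simp add: mult.assoc)

lemma cinner_commute: "cinner f g = cnj (cinner g f)"
  by transfer (subst Bochner_Integration.integral_cnj[symmetric], simp add: mult.commute)

lemma cinner_self:
  assumes "square_integrable f"
  shows "integral\<^sup>L circle (\<lambda>z. f z * cnj (f z)) = of_real (integral\<^sup>L circle (\<lambda>z. (norm (f z))\<^sup>2))"
  by (simp add: complex_norm_square[symmetric] del: of_real_power)

instantiation L2 :: scaleR
begin

definition scaleR_L2 :: "real \<Rightarrow> L2 \<Rightarrow> L2" where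
  "scaleR_L2 r f = complex_of_real r *\<^sub>C f"

instance ..

end

text \<open>The real inner product is the real part of the complex one, so that the norm is the usual
  \<open>L\<^sup>2\<close> norm.\<close>

instantiation L2 :: real_inner
begin

definition inner_L2 :: "L2 \<Rightarrow> L2 \<Rightarrow> real" where
  "inner_L2 f g = Re (cinner f g)"

definition norm_L2 :: "L2 \<Rightarrow> real" where
  "norm_L2 f = sqrt (inner f f)"

definition sgn_L2 :: "L2 \<Rightarrow> L2" where
  "sgn_L2 f = f /\<^sub>R norm f"

definition dist_L2 :: "L2 \<Rightarrow> L2 \<Rightarrow> real" where
  "dist_L2 f g = norm (f - g)"

definition uniformity_L2 :: "(L2 \<times> L2) filter" where
  "uniformity_L2 = (INF e\<in>{0<..}. principal {(x, y). dist x y < e})"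

definition open_L2 :: "L2 set \<Rightarrow> bool" where
  "open_L2 S \<longleftrightarrow> (\<forall>x\<in>S. \<forall>\<^sub>F (x', y) in uniformity. x' = x \<longrightarrow> y \<in> S)"

instance
proof
  fix x y z :: L2 and a b r :: real and S :: "L2 set"
  show "dist x y = norm (x - y)" by (rule dist_L2_def)
  show "sgn x = x /\<^sub>R norm x" by (rule sgn_L2_def)
  show "uniformity = (INF e\<in>{0<..}. principal {(x::L2, y). dist x y < e})"
    by (rule uniformity_L2_def)
  show "open S \<longleftrightarrow> (\<forall>x\<in>S. \<forall>\<^sub>F (x', y) in uniformity. x' = x \<longrightarrow> y \<in> S)"
    by (rule open_L2_def)
  show "a *\<^sub>R (x + y) = a *\<^sub>R x + a *\<^sub>R y"
    unfolding scaleR_L2_def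
    by transfer (auto simp: L2_rel_def distrib_left square_integrable_add square_integrable_scale)
  show "(a + b) *\<^sub>R x = a *\<^sub>R x + b *\<^sub>R x"
    unfolding scaleR_L2_def
    by transfer (auto simp: L2_rel_def distrib_right square_integrable_add square_integrable_scale)
  show "a *\<^sub>R b *\<^sub>R x = (a * b) *\<^sub>R x"
    unfolding scaleR_L2_def
    by transfer (auto simp: L2_rel_def mult.assoc square_integrable_scale simp flip: of_real_mult)
  show "1 *\<^sub>R x = x"
    unfolding scaleR_L2_def by transfer (auto simp: L2_rel_def)
  show "inner x y = inner y x"
    by (metis inner_L2_def cinner_commute complex_cnj(1) complex.sel(1) complex_surj)
  show "inner (x + y) z = inner x z + inner y z"
    by (simp add: inner_L2_def cinner_add_left)
  show "inner (r *\<^sub>R x) y = r * inner x y"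
    by (simp add: inner_L2_def scaleR_L2_def cinner_scaleC_left)
  show "0 \<le> inner x x"
    unfolding inner_L2_def by transfer (simp add: cinner_self L2_rel_def)
  show "inner x x = 0 \<longleftrightarrow> x = 0"
    unfolding inner_L2_def
  proof transfer
    fix f assume "L2_rel f f"
    then have f: "square_integrable f" by (simp add: L2_rel_def)
    then have "Re (integral\<^sup>L circle (\<lambda>z. f z * cnj (f z))) = 0 \<longleftrightarrow>
        integral\<^sup>L circle (\<lambda>z. (norm (f z))\<^sup>2) = 0"
      by (simp add: cinner_self)
    also have "\<dots> \<longleftrightarrow> (AE z in circle. (norm (f z))\<^sup>2 = 0)"
      using f by (intro integral_nonneg_eq_0_iff_AE) (auto simp: square_integrable_def)
    finally show "Re (integral\<^sup>L circle (\<lambda>z. f z * cnj (f z))) = 0 \<longleftrightarrow> L2_rel f (\<lambda>_. 0)"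
      using f by (simp add: L2_rel_def)
  qed
  show "norm x = sqrt (inner x x)" by (rule norm_L2_def)
qed

end


section \<open>Multiplication, flip, Fourier coefficients, Hardy space\<close>

text \<open>Multiplication by an essentially bounded function; the value for other symbols is a dummy.\<close>

lift_definition mult_L2 :: "(complex \<Rightarrow> complex) \<Rightarrow> L2 \<Rightarrow> L2"
  is "\<lambda>\<phi> f. if \<phi> \<in> Linf then (\<lambda>z. \<phi> z * f z) else (\<lambda>_. 0)"
  by (auto simp: L2_rel_def square_integrable_mult)

lift_definition flip :: "L2 \<Rightarrow> L2" is "\<lambda>f z. f (cnj z)"
proof -
  fix f g assume fg: "L2_rel f g"
  then have "AE z in circle. f (cnj z) = g (cnj z)"
    by (intro AE_circle_cnj[where P = "\<lambda>z. f z = g z"]) (simp add: L2_rel_def)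
  with fg show "L2_rel (\<lambda>z. f (cnj z)) (\<lambda>z. g (cnj z))"
    by (simp add: L2_rel_def square_integrable_cnj_arg)
qed

definition fourier_coeff :: "L2 \<Rightarrow> int \<Rightarrow> complex" where
  "fourier_coeff f n = cinner f (class_L2 (\<lambda>z. z powi n))"

definition H2 :: "L2 set" where
  "H2 = {f. \<forall>n<0. fourier_coeff f n = 0}"

definition ominus :: "L2 set \<Rightarrow> L2 set \<Rightarrow> L2 set" (infixl "\<ominus>" 65) where
  "V \<ominus> W = {f \<in> V. \<forall>g\<in>W. cinner f g = 0}"

definition orth_proj :: "L2 set \<Rightarrow> L2 \<Rightarrow> L2" where
  "orth_proj V f = (THE p. p \<in> V \<and> (\<forall>v\<in>V. cinner (f - p) v = 0))"

definition hardy_proj :: "L2 \<Rightarrow> L2" where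
  "hardy_proj = orth_proj H2"

definition cohardy_proj :: "L2 \<Rightarrow> L2" where
  "cohardy_proj f = f - hardy_proj f"


section \<open>Inner functions and the spaces they define\<close>

text \<open>An inner function is given on the disk together with its radial boundary values on the
  circle. The measurability condition only selects a Borel version of these boundary values.\<close>

definition inner_function :: "(complex \<Rightarrow> complex) \<Rightarrow> bool" where
  "inner_function \<theta> \<longleftrightarrow>
     \<theta> holomorphic_on ball 0 1 \<and> bounded (\<theta> ` ball 0 1) \<and>
     \<theta> \<in> borel_measurable circle \<and>
     (AE z in circle. ((\<lambda>r. \<theta> (complex_of_real r * z)) \<longlongrightarrow> \<theta> z) (at_left 1)) \<and>
     (AE z in circle. norm (\<theta> z) = 1)"

definition model_space :: "(complex \<Rightarrow> complex) \<Rightarrow> L2 set" where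
  "model_space \<theta> = H2 \<ominus> mult_L2 \<theta> ` H2"

definition model_perp :: "(complex \<Rightarrow> complex) \<Rightarrow> L2 set" where
  "model_perp \<theta> = UNIV \<ominus> model_space \<theta>"

definition perp_proj :: "(complex \<Rightarrow> complex) \<Rightarrow> L2 \<Rightarrow> L2" where
  "perp_proj \<theta> f = cohardy_proj f + mult_L2 \<theta> (hardy_proj (mult_L2 (\<lambda>z. cnj (\<theta> z)) f))"


section \<open>Operators on the orthogonal complement of the model space\<close>

text \<open>Operators on a subspace \<open>V\<close> are total functions of which only the values on \<open>V\<close> matter.\<close>

definition bounded_operator_on :: "L2 set \<Rightarrow> (L2 \<Rightarrow> L2) \<Rightarrow> bool" where
  "bounded_operator_on V A \<longleftrightarrow>
     (\<forall>f\<in>V. A f \<in> V) \<and>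
     (\<forall>f\<in>V. \<forall>g\<in>V. A (f + g) = A f + A g) \<and>
     (\<forall>c. \<forall>f\<in>V. A (c *\<^sub>C f) = c *\<^sub>C A f) \<and>
     (\<exists>B. \<forall>f\<in>V. norm (A f) \<le> B * norm f)"

definition adjoint_on :: "L2 set \<Rightarrow> (L2 \<Rightarrow> L2) \<Rightarrow> L2 \<Rightarrow> L2" where
  "adjoint_on V A g = (THE k. k \<in> V \<and> (\<forall>f\<in>V. cinner (A f) g = cinner f k))"

definition dual_truncated_Hankel ::
    "(complex \<Rightarrow> complex) \<Rightarrow> (complex \<Rightarrow> complex) \<Rightarrow> L2 \<Rightarrow> L2" where
  "dual_truncated_Hankel \<theta> \<phi> h = perp_proj \<theta> (flip (mult_L2 \<phi> h))"

definition compressed_shift :: "(complex \<Rightarrow> complex) \<Rightarrow> L2 \<Rightarrow> L2" where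
  "compressed_shift \<theta> h = perp_proj \<theta> (mult_L2 (\<lambda>z. z) h)"

definition rank_one :: "L2 \<Rightarrow> L2 \<Rightarrow> L2 \<Rightarrow> L2" (infix "\<otimes>" 70) where
  "(f \<otimes> g) h = cinner h g *\<^sub>C f"

definition star :: "(complex \<Rightarrow> complex) \<Rightarrow> complex \<Rightarrow> complex" where
  "star \<phi> z = cnj (\<phi> (cnj z))"

definition theta0 :: "(complex \<Rightarrow> complex) \<Rightarrow> complex" where
  "theta0 \<theta> = fourier_coeff (class_L2 \<theta>) 0"

definition alpha :: "(complex \<Rightarrow> complex) \<Rightarrow> (complex \<Rightarrow> complex) \<Rightarrow> complex \<Rightarrow> complex" where
  "alpha \<theta> \<phi> z = \<phi> z * (\<theta> z - theta0 \<theta>)"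

definition delta :: "(complex \<Rightarrow> complex) \<Rightarrow> (complex \<Rightarrow> complex) \<Rightarrow> complex" where
  "delta \<theta> \<phi> = cnj (theta0 \<theta>) *
     cinner (class_L2 (\<lambda>z. \<phi> z * \<theta> z * (star \<theta> z - cnj (theta0 \<theta>)))) (class_L2 (\<lambda>z. z))"

end

theory Submission
  imports Defs "HOL-Complex_Analysis.Cauchy_Integral_Formula"
begin

text \<open>The dual truncated Hankel operator \<open>H\<close> satisfies the same displacement identity as \<open>A\<close>
  (\<open>Hankel_identity\<close>). The reason is that the flip conjugates multiplication by \<open>z\<close> into multiplication
  by \<open>cnj z\<close>, so that \<open>H\<close> would equal \<open>U H U\<close> if \<open>U\<close> were multiplication by \<open>z\<close>; the two compressions
  in \<open>U\<close> each contribute a term of rank one. These are read off from one commutation rule (\<open>R_S\<close>): the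
  Hardy projection commutes with multiplication by \<open>z\<close> except for the coefficient of index \<open>-1\<close>.

  The difference \<open>D = A - H\<close> therefore satisfies \<open>D = U D U\<close>, and the theorem says when this forces
  \<open>D = 0\<close> (\<open>rigidity\<close>). Suppose \<open>D \<theta> = 0\<close>. Since \<open>U\<close> maps \<open>cnj z\<close> to a multiple of \<open>\<theta>\<close> and every higher
  power of \<open>cnj z\<close> to the preceding one, \<open>D\<close> vanishes on all of them. Since \<open>U\<close> maps \<open>\<theta> z\<^sup>n\<close> to the
  next such function, \<open>U\<close> kills the value of \<open>D\<close> at the next one as soon as \<open>D\<close> vanishes at the
  present one. If \<open>\<theta>\<^sub>0 \<noteq> 0\<close> then \<open>U\<close> is injective and \<open>D\<close> vanishes on all functions \<open>\<theta> z\<^sup>n\<close>. If \<open>\<theta>\<^sub>0 = 0\<close>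
  then the kernel of \<open>U\<close> is the line through \<open>cnj z\<close>, and the condition on the adjoints says that the
  range of \<open>D\<close> is orthogonal to that line, so the same conclusion holds
  (\<open>compressed_shift_injective\<close>). By density and continuity \<open>D = 0\<close>.

  Underneath lie three facts about \<open>L\<^sup>2\<close> of the circle. Fourier coefficients determine the function
  (\<open>fourier_uniqueness\<close>), which gives density of the powers. The space is complete, which gives
  orthogonal projections (\<open>projection_theorem\<close>) and, through the Riesz representation, the adjoints in
  the statement. The boundary function of an inner function lies in the Hardy space
  (\<open>theta_coeff_negative\<close>), and multiplication by it preserves that space (\<open>T_H2\<close>).\<close>

section \<open>Integration on the circle\<close>

lemma emeasure_circle_space: "emeasure circle (space circle) = 1"
proof -
  have "cis \<in> measurable (uniform_measure lborel {-pi..pi}) (restrict_space borel (sphere 0 1))"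
    using measurable_cis_sphere
    by (simp add: measurable_cong_sets[of "uniform_measure lborel {-pi..pi}" borel])
  moreover have "sphere 0 1 \<in> sets (restrict_space borel (sphere 0 1 :: complex set))"
    using sets.top[of "restrict_space borel (sphere 0 1 :: complex set)"]
    by (simp add: space_restrict_space)
  ultimately have "emeasure circle (space circle) =
      emeasure (uniform_measure lborel {-pi..pi}) (cis -` space circle \<inter> UNIV)"
    unfolding space_circle unfolding circle_def by (subst emeasure_distr) auto
  also have "\<dots> = emeasure (uniform_measure lborel {-pi..pi}) UNIV"
    by (rule arg_cong2[where f = emeasure]) auto
  also have "\<dots> = 1"
    by (subst emeasure_uniform_measure) (auto simp: emeasure_lborel_Icc_eq divide_ennreal)
  finally show ?thesis .
qed

interpretation circle: finite_measure circle
  by standard (use emeasure_circle_space in simp)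

lemma measure_circle_space [simp]: "measure circle (sphere 0 1) = 1"
  using emeasure_circle_space by (simp add: measure_def)

lemma AE_circle_sphere: "AE z in circle. z \<in> sphere 0 1"
  using AE_space[of circle] by simp

lemma borel_measurable_circle_continuous:
  fixes g :: "complex \<Rightarrow> 'a::topological_space"
  assumes "continuous_on (sphere 0 1) g"
  shows "g \<in> borel_measurable circle"
  using borel_measurable_continuous_on_restrict[OF assms]
  by (simp add: measurable_cong_sets[OF sets_circle refl])

lemma borel_measurable_cnj [measurable (raw)]:
  "f \<in> borel_measurable M \<Longrightarrow> (\<lambda>x. cnj (f x)) \<in> borel_measurable M"
  by (rule measurable_compose[where N = borel])
     (auto intro!: borel_measurable_continuous_onI continuous_intros)

lemma borel_measurable_circle_powi [measurable]: "(\<lambda>z. z powi n) \<in> borel_measurable circle"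
  by (rule borel_measurable_circle_continuous) (auto intro!: continuous_intros)

lemma borel_measurable_circle_id [measurable]: "(\<lambda>z. z) \<in> borel_measurable circle"
  by (rule borel_measurable_circle_continuous) (auto intro!: continuous_intros)

lemma borel_measurable_circle_cnj_arg:
  "f \<in> borel_measurable circle \<Longrightarrow> (\<lambda>z. f (cnj z)) \<in> borel_measurable circle"
  by (rule measurable_compose[OF measurable_cnj_circle])

lemma borel_measurable_circle_indicator:
  "A \<in> sets borel \<Longrightarrow> (indicator A :: complex \<Rightarrow> real) \<in> borel_measurable circle"
  by (subst measurable_cong_sets[OF sets_circle refl], intro measurable_restrict_space1) auto

lemma integrable_circle_indicator:
  fixes f :: "complex \<Rightarrow> complex"
  assumes "A \<in> sets borel" "integrable circle f"
  shows "integrable circle (\<lambda>z. indicator A z *\<^sub>R f z)"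
proof (rule Bochner_Integration.integrable_bound[OF assms(2)])
  show "(\<lambda>z. indicator A z *\<^sub>R f z) \<in> borel_measurable circle"
    using assms by (intro borel_measurable_scaleR borel_measurable_circle_indicator) auto
  show "AE z in circle. norm (indicator A z *\<^sub>R f z) \<le> norm (f z)"
    by (intro AE_I2) (auto split: split_indicator)
qed

lemma integral_circle_eq:
  fixes g :: "complex \<Rightarrow> complex"
  assumes "g \<in> borel_measurable circle"
  shows "integral\<^sup>L circle g =
    integral\<^sup>L lborel (\<lambda>t. indicator {-pi..pi} t *\<^sub>R (g (cis t) / (2 * pi)))"
proof -
  have c: "cis \<in> measurable borel circle"
    using measurable_cis_sphere by (simp add: measurable_cong_sets[OF refl sets_circle])
  have gc [measurable]: "(\<lambda>t. g (cis t)) \<in> borel_measurable borel"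
    using measurable_compose[OF c assms] .
  have U: "uniform_measure lborel {-pi..pi} =
      density lborel (\<lambda>t::real. ennreal (indicator {-pi..pi} t / (2 * pi)))"
    unfolding uniform_measure_def
    by (rule density_cong) (auto simp: indicator_def emeasure_lborel_Icc_eq divide_ennreal[symmetric] 
        simp flip: ennreal_1 intro!: AE_I2)
  have "integral\<^sup>L circle g = integral\<^sup>L (uniform_measure lborel {-pi..pi}) (\<lambda>t. g (cis t))"
    unfolding circle_def using assms measurable_cis_sphere
    by (subst integral_distr)
       (simp_all add: measurable_cong_sets[of "uniform_measure lborel {-pi..pi}" borel]
          measurable_cong_sets[OF sets_circle refl])
  also have "\<dots> = integral\<^sup>L lborel (\<lambda>t. (indicator {-pi..pi} t / (2 * pi)) *\<^sub>R g (cis t))"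
    unfolding U by (rule integral_density) (auto simp: gc)
  also have "\<dots> = integral\<^sup>L lborel (\<lambda>t. indicator {-pi..pi} t *\<^sub>R (g (cis t) / (2 * pi)))"
    by (rule Bochner_Integration.integral_cong) (auto simp: scaleR_conv_of_real)
  finally show ?thesis .
qed

lemma integral_circle_powi:
  "integral\<^sup>L circle (\<lambda>z. z powi n) = (if n = 0 then 1 else 0)"
proof (cases "n = 0")
  case True
  then show ?thesis by (simp add: measure_circle_space)
next
  case False
  define K where "K = \<i> * of_int n * complex_of_real (2 * pi)"
  have K: "K \<noteq> 0" using False by (simp add: K_def)
  define F where "F t = inverse K * exp (t *\<^sub>R (\<i> * of_int n))" for t :: real
  have cis: "exp (t *\<^sub>R (\<i> * of_int n)) = cis (of_int n * t)" for t :: real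
    by (simp add: cis_conv_exp scaleR_conv_of_real mult_ac)
  have D: "(F has_vector_derivative (cis t powi n / (2 * pi))) (at t within {-pi..pi})" for t
  proof -
    have "(F has_vector_derivative inverse K * (exp (t *\<^sub>R (\<i> * of_int n)) * (\<i> * of_int n)))
        (at t within {-pi..pi})"
      unfolding F_def
      by (rule bounded_linear.has_vector_derivative[OF bounded_linear_mult_right
            exp_scaleR_has_vector_derivative_right])
    also have "inverse K * (exp (t *\<^sub>R (\<i> * of_int n)) * (\<i> * of_int n)) = cis t powi n / (2 * pi)"
      unfolding cis using False by (simp add: K_def cis_power_int field_simps)
    finally show ?thesis .
  qed
  have "integral\<^sup>L circle (\<lambda>z. z powi n) = F pi - F (- pi)"
    by (subst integral_circle_eq, simp, rule integral_FTC_atLeastAtMost, simp, rule D)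
       (auto intro!: continuous_intros)
  also have "\<dots> = 0"
  proof -
    have "cis (of_int n * pi) = cis (of_int n * - pi)"
      using sin_npi_int[of n] by (simp add: complex_eq_iff mult.commute)
    then show ?thesis unfolding F_def cis by simp
  qed
  finally show ?thesis using False by simp
qed

lemma integrable_circle_mult_continuous:
  fixes f g :: "complex \<Rightarrow> complex"
  assumes f: "integrable circle f" and g: "continuous_on (sphere 0 1) g"
  shows "integrable circle (\<lambda>z. f z * g z)"
proof -
  have "compact (g ` sphere 0 1)"
    using g by (rule compact_continuous_image) simp
  then obtain B where "\<forall>x\<in>g ` sphere 0 1. norm x \<le> B"
    using compact_imp_bounded bounded_iff by metis
  then have B: "norm (g z) \<le> B" if "z \<in> sphere 0 1" for z
    using that by simp
  note [measurable] = borel_measurable_circle_continuous[OF g] borel_measurable_integrable[OF f]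
  show ?thesis
  proof (rule Bochner_Integration.integrable_bound)
    show "integrable circle (\<lambda>z. B *\<^sub>R f z)" using f by simp
    show "AE z in circle. norm (f z * g z) \<le> norm (B *\<^sub>R f z)"
      using AE_circle_sphere
    proof eventually_elim
      case (elim z)
      have "norm (g z) \<le> \<bar>B\<bar>" using B[OF elim] by simp
      from mult_left_mono[OF this norm_ge_zero[of "f z"]] show ?case
        by (simp add: norm_mult mult.commute)
    qed
  qed simp
qed

section \<open>Uniqueness of Fourier coefficients\<close>

text \<open>The class of integrable functions all of whose Fourier coefficients vanish is closed under
  multiplication by \<open>z\<close> and \<open>cnj z\<close>, hence by any real-linear function of \<open>z\<close>, hence by any real
  polynomial function. Arguing with the class as a whole avoids expanding a polynomial into
  powers of \<open>z\<close>.\<close>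

lemma annihilator_mult_polynomial:
  fixes f :: "complex \<Rightarrow> complex"
  assumes "real_polynomial_function p"
    and "integrable circle f" "\<And>n. integral\<^sup>L circle (\<lambda>z. f z * z powi n) = 0"
  shows "integrable circle (\<lambda>z. f z * of_real (p z)) \<and>
    (\<forall>n. integral\<^sup>L circle (\<lambda>z. f z * of_real (p z) * z powi n) = 0)"
  using assms
proof (induction p arbitrary: f rule: real_polynomial_function.induct)
  case (linear p)
  \<comment> \<open>on the circle the real-linear function \<open>p\<close> is \<open>w * z + cnj w / z\<close>\<close>
  define w where "w = (complex_of_real (p 1) - \<i> * of_real (p \<i>)) / 2"
  have p: "complex_of_real (p z) = w * z + cnj w * z powi (-1)" if "z \<in> sphere 0 1" for z
  proof -
    have "z * cnj z = 1" using that by (simp add: complex_norm_square[symmetric])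
    then have inv: "z powi (-1) = cnj z"
      using inverse_unique[of z "cnj z"] by (simp add: power_int_minus)
    have "p z = p (Re z *\<^sub>R 1 + Im z *\<^sub>R \<i>)"
      by (rule arg_cong[of _ _ p]) (simp add: complex_eq_iff)
    also have "\<dots> = Re z * p 1 + Im z * p \<i>"
      using linear by (simp add: linear_simps)
    finally show ?thesis unfolding inv w_def by (simp add: complex_eq_iff field_simps)
  qed
  have I: "integrable circle (\<lambda>z. f z * z powi n)" for n
    using linear by (intro integrable_circle_mult_continuous) (auto intro!: continuous_intros)
  have "continuous_on (sphere 0 1) (\<lambda>z. complex_of_real (p z))"
    using linear(1) by (intro continuous_intros linear_continuous_on)
  then have "integrable circle (\<lambda>z. f z * of_real (p z))"
    using linear by (intro integrable_circle_mult_continuous) auto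
  moreover have "integral\<^sup>L circle (\<lambda>z. f z * of_real (p z) * z powi n) = 0" for n
  proof -
    have "integral\<^sup>L circle (\<lambda>z. f z * of_real (p z) * z powi n) =
        integral\<^sup>L circle (\<lambda>z. w * (f z * z powi (n + 1)) + cnj w * (f z * z powi (n - 1)))"
    proof (rule Bochner_Integration.integral_cong)
      fix z assume "z \<in> space circle"
      then have z: "z \<in> sphere 0 1" "z \<noteq> 0" by auto
      show "f z * of_real (p z) * z powi n =
          w * (f z * z powi (n + 1)) + cnj w * (f z * z powi (n - 1))"
        unfolding p[OF z(1)] using z(2) by (simp add: power_int_add power_int_diff field_simps power_int_minus)
    qed simp
    also have "\<dots> = 0" using I linear(3) by simp
    finally show ?thesis .
  qed
  ultimately show ?case by blast
next
  case (const c)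
  then show ?case by (simp add: mult.assoc mult.left_commute[of _ "of_real c"])
next
  case (add p q)
  have I: "integrable circle (\<lambda>z. f z * of_real (p z))" "integrable circle (\<lambda>z. f z * of_real (q z))"
    and Z: "integral\<^sup>L circle (\<lambda>z. f z * of_real (p z) * z powi n) = 0"
      "integral\<^sup>L circle (\<lambda>z. f z * of_real (q z) * z powi n) = 0" for n
    using add.IH(1)[OF add.prems] add.IH(2)[OF add.prems] by auto
  have J: "integrable circle (\<lambda>z. f z * of_real (p z) * z powi n)"
    "integrable circle (\<lambda>z. f z * of_real (q z) * z powi n)" for n
    by (rule integrable_circle_mult_continuous[OF I(1)] integrable_circle_mult_continuous[OF I(2)];
        auto intro!: continuous_intros)+
  show ?case
    using I J Z by (simp add: ring_distribs)
next
  case (mult p q)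
  have "integrable circle (\<lambda>z. f z * of_real (p z))"
    "integral\<^sup>L circle (\<lambda>z. f z * of_real (p z) * z powi n) = 0" for n
    using mult.IH(1)[OF mult.prems] by auto
  from mult.IH(2)[OF this] show ?case by (simp add: mult.assoc)
qed

text \<open>By the Stone-Weierstrass theorem a continuous function is a uniform limit of polynomial ones,
  and \<open>f\<close> is integrable.\<close>

lemma annihilator_continuous:
  fixes f :: "complex \<Rightarrow> complex" and g :: "complex \<Rightarrow> real"
  assumes f: "integrable circle f" "\<And>n. integral\<^sup>L circle (\<lambda>z. f z * z powi n) = 0"
    and g: "continuous_on (sphere 0 1) g"
  shows "integral\<^sup>L circle (\<lambda>z. f z * of_real (g z)) = 0"
proof -
  define K where "K = integral\<^sup>L circle (\<lambda>z. norm (f z))"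
  have K0: "K \<ge> 0" unfolding K_def by simp
  have gi: "integrable circle (\<lambda>z. f z * of_real (g z))"
    using f g by (intro integrable_circle_mult_continuous) (auto intro!: continuous_intros)
  have "norm (integral\<^sup>L circle (\<lambda>z. f z * of_real (g z))) \<le> K * e" if "e > 0" for e
  proof -
    obtain p where p: "real_polynomial_function p" "\<And>z. z \<in> sphere 0 1 \<Longrightarrow> \<bar>g z - p z\<bar> < e"
      using Stone_Weierstrass_real_polynomial_function[of "sphere 0 1" g e] g \<open>e > 0\<close> by auto
    note ann = annihilator_mult_polynomial[OF p(1) f]
    have "integral\<^sup>L circle (\<lambda>z. f z * of_real (p z)) = 0"
      using conjunct2[OF ann, rule_format, of 0] by simp
    then have "integral\<^sup>L circle (\<lambda>z. f z * of_real (g z)) =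
        integral\<^sup>L circle (\<lambda>z. f z * of_real (g z) - f z * of_real (p z))"
      using ann gi by simp
    also have "norm \<dots> \<le> integral\<^sup>L circle (\<lambda>z. norm (f z) * e)"
    proof (rule order_trans[OF integral_norm_bound integral_mono])
      show "integrable circle (\<lambda>z. norm (f z * of_real (g z) - f z * of_real (p z)))"
        using ann gi by simp
      show "integrable circle (\<lambda>z. norm (f z) * e)" using f by simp
      fix z assume "z \<in> space circle"
      then have "\<bar>g z - p z\<bar> \<le> e" using p(2)[of z] by simp
      then show "norm (f z * of_real (g z) - f z * of_real (p z)) \<le> norm (f z) * e"
        by (simp add: norm_mult mult_left_mono flip: right_diff_distrib of_real_diff)
    qed
    also have "\<dots> = K * e" by (simp add: K_def)
    finally show ?thesis .
  qed
  from this[of "e / (K + 1)" for e] have "norm (integral\<^sup>L circle (\<lambda>z. f z * of_real (g z))) \<le> e" if "e > 0" for e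
  proof -
    have "K * (e / (K + 1)) \<le> e" using that K0 by (simp add: field_simps)
    moreover have "e / (K + 1) > 0" using that K0 by simp
    ultimately show ?thesis
      using \<open>\<And>e. 0 < e / (K + 1) \<Longrightarrow> _\<close>[of e] by linarith
  qed
  then have "norm (integral\<^sup>L circle (\<lambda>z. f z * of_real (g z))) \<le> 0"
    by (rule field_le_epsilon) simp
  then show ?thesis by simp
qed

text \<open>The indicator of a closed set is a bounded pointwise limit of continuous functions of the
  distance to it.\<close>

lemma annihilator_closed:
  fixes f :: "complex \<Rightarrow> complex"
  assumes f: "integrable circle f" "\<And>n. integral\<^sup>L circle (\<lambda>z. f z * z powi n) = 0"
    and C: "closed C"
  shows "integral\<^sup>L circle (\<lambda>z. indicator C z *\<^sub>R f z) = 0"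
proof (cases "C = {}")
  case False
  note [measurable] = borel_measurable_integrable[OF f(1)]
  define g where "g n z = max 0 (1 - real n * infdist z C)" for n z
  have gc: "continuous_on (sphere 0 1) (g n)" for n
    unfolding g_def by (intro continuous_intros)
  note gm [measurable] = borel_measurable_circle_continuous[OF gc]
  have lim: "(\<lambda>n. g n z) \<longlonglongrightarrow> indicator C z" for z
  proof (cases "z \<in> C")
    case True
    then show ?thesis by (simp add: g_def)
  next
    case out: False
    then have d: "infdist z C > 0"
      using C False by (metis infdist_nonneg in_closed_iff_infdist_zero order_le_less)
    have "\<forall>\<^sub>F n in sequentially. 1 / infdist z C \<le> real n"
      by (rule eventually_sequentiallyI[of "nat \<lceil>1 / infdist z C\<rceil>"]) linarith
    then have "\<forall>\<^sub>F n in sequentially. g n z = 0"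
      by eventually_elim (use d in \<open>auto simp: g_def field_simps\<close>)
    then show ?thesis using out by (simp add: tendsto_eventually)
  qed
  have "(\<lambda>n. integral\<^sup>L circle (\<lambda>z. g n z *\<^sub>R f z)) \<longlonglongrightarrow> integral\<^sup>L circle (\<lambda>z. indicator C z *\<^sub>R f z)"
  proof (rule integral_dominated_convergence[where w = "\<lambda>z. norm (f z)"])
    show "(\<lambda>z. indicator C z *\<^sub>R f z) \<in> borel_measurable circle"
      by (intro borel_measurable_scaleR borel_measurable_circle_indicator) (use C in auto)
    show "AE z in circle. (\<lambda>n. g n z *\<^sub>R f z) \<longlonglongrightarrow> indicator C z *\<^sub>R f z"
      by (intro AE_I2 tendsto_intros lim)
    show "AE z in circle. norm (g n z *\<^sub>R f z) \<le> norm (f z)" for n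
      by (intro AE_I2) (auto simp: g_def infdist_nonneg intro!: mult_left_le_one_le)
  qed (use f in auto)
  moreover have "integral\<^sup>L circle (\<lambda>z. g n z *\<^sub>R f z) = 0" for n
    using annihilator_continuous[OF f gc, of n] by (simp add: scaleR_conv_of_real mult.commute)
  ultimately show ?thesis by (simp add: LIMSEQ_const_iff)
qed auto

text \<open>The closed sets are stable under intersection and generate the Borel sets, and the sets on
  which \<open>f\<close> integrates to zero form a Dynkin system.\<close>

lemma annihilator_borel:
  fixes f :: "complex \<Rightarrow> complex"
  assumes f: "integrable circle f" "\<And>n. integral\<^sup>L circle (\<lambda>z. f z * z powi n) = 0"
    and A: "A \<in> sets borel"
  shows "integral\<^sup>L circle (\<lambda>z. indicator A z *\<^sub>R f z) = 0"
proof -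
  note [measurable] = borel_measurable_integrable[OF f(1)]
  note int = integrable_circle_indicator[OF _ f(1)]
  have sb: "sets borel = sigma_sets UNIV (Collect closed :: complex set set)"
    by (simp add: borel_eq_closed)
  have "Int_stable (Collect closed :: complex set set)" by (auto simp: Int_stable_def)
  moreover have "(Collect closed :: complex set set) \<subseteq> Pow UNIV" by simp
  moreover have "A \<in> sigma_sets UNIV (Collect closed)" using A by (simp add: sb)
  ultimately show ?thesis
  proof (induct A rule: sigma_sets_induct_disjoint)
    case (basic A)
    then show ?case using annihilator_closed[OF f] by simp
  next
    case (compl A)
    then have "A \<in> sets borel" by (simp add: sb)
    have "integral\<^sup>L circle (\<lambda>z. indicator (UNIV - A) z *\<^sub>R f z) =
        integral\<^sup>L circle (\<lambda>z. f z - indicator A z *\<^sub>R f z)"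
      by (rule Bochner_Integration.integral_cong) (auto simp: indicator_def)
    also have "\<dots> = 0"
      using compl f(2)[of 0] f(1) int[OF \<open>A \<in> sets borel\<close>] by simp
    finally show ?case .
  next
    case (union A)
    have A: "A i \<in> sets borel" for i using union by (auto simp: sb)
    then have U: "(\<Union>i. A i) \<in> sets borel" by auto
    have "(\<lambda>n. integral\<^sup>L circle (\<lambda>z. indicator (\<Union>i<n. A i) z *\<^sub>R f z))
        \<longlonglongrightarrow> integral\<^sup>L circle (\<lambda>z. indicator (\<Union>i. A i) z *\<^sub>R f z)"
    proof (rule integral_dominated_convergence[where w = "\<lambda>z. norm (f z)"])
      show "(\<lambda>z. indicator (\<Union>i. A i) z *\<^sub>R f z) \<in> borel_measurable circle"
        by (intro borel_measurable_integrable int U)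
      show "(\<lambda>z. indicator (\<Union>i<n. A i) z *\<^sub>R f z) \<in> borel_measurable circle" for n
        by (intro borel_measurable_integrable int) (use A in auto)
      show "AE z in circle. (\<lambda>n. indicator (\<Union>i<n. A i) z *\<^sub>R f z) \<longlonglongrightarrow> indicator (\<Union>i. A i) z *\<^sub>R f z"
        by (intro AE_I2 tendsto_intros LIMSEQ_indicator_UN)
    qed (use f in \<open>auto simp: indicator_def\<close>)
    moreover have "integral\<^sup>L circle (\<lambda>z. indicator (\<Union>i<n. A i) z *\<^sub>R f z) = 0" for n
    proof (induction n)
      case (Suc n)
      have "A i \<inter> A n = {}" if "i < n" for i
        using union(1) that unfolding disjoint_family_on_def by (metis UNIV_I less_irrefl)
      then have "(\<Union>i<n. A i) \<inter> A n = {}" by blast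
      then have "integral\<^sup>L circle (\<lambda>z. indicator (\<Union>i<Suc n. A i) z *\<^sub>R f z) =
          integral\<^sup>L circle (\<lambda>z. indicator (\<Union>i<n. A i) z *\<^sub>R f z + indicator (A n) z *\<^sub>R f z)"
        by (intro Bochner_Integration.integral_cong) (auto simp: indicator_def lessThan_Suc)
      also have "\<dots> = 0"
        using Suc union(3)[of n] by (subst Bochner_Integration.integral_add) (use A in \<open>auto intro!: int\<close>)
      finally show ?case .
    qed simp
    ultimately show ?case by (simp add: LIMSEQ_const_iff)
  qed simp
qed

text \<open>A real integrable function that integrates to zero over the set where it is positive is
  almost everywhere nonpositive. This applies to the real and imaginary parts of \<open>f\<close> and to their
  negatives.\<close>

theorem fourier_uniqueness_integrable:
  fixes f :: "complex \<Rightarrow> complex"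
  assumes f: "integrable circle f" "\<And>n. integral\<^sup>L circle (\<lambda>z. f z * z powi n) = 0"
  shows "AE z in circle. f z = 0"
proof -
  note [measurable] = borel_measurable_integrable[OF f(1)]
  have sub: "A \<in> sets borel" if "A \<in> sets circle" for A
    using that by (auto simp: sets_circle sets_restrict_space)
  have *: "AE z in circle. u z \<le> 0"
    if u: "integrable circle u"
      and z: "\<And>A. A \<in> sets borel \<Longrightarrow> integral\<^sup>L circle (\<lambda>z. indicator A z *\<^sub>R u z) = 0"
    for u :: "complex \<Rightarrow> real"
  proof -
    note [measurable] = borel_measurable_integrable[OF u]
    define A where "A = {z \<in> space circle. u z > 0}"
    have A [measurable]: "A \<in> sets circle" unfolding A_def by measurable
    have i: "integrable circle (\<lambda>z. indicator A z *\<^sub>R u z)"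
      by (rule integrable_mult_indicator[OF A u])
    have "AE z in circle. indicator A z *\<^sub>R u z = 0"
      using z[OF sub[OF A]] integral_nonneg_eq_0_iff_AE[OF i]
      by (auto simp: A_def indicator_def)
    then show ?thesis
      using AE_space by eventually_elim (auto simp: A_def indicator_def split: if_splits)
  qed
  have Z: "integral\<^sup>L circle (\<lambda>z. indicator A z *\<^sub>R h (f z)) = 0"
    if "bounded_linear h" "A \<in> sets borel" for A and h :: "complex \<Rightarrow> real"
  proof -
    interpret h: bounded_linear h by fact
    show ?thesis
      using integral_bounded_linear[OF that(1) integrable_circle_indicator[OF that(2) f(1)]]
        annihilator_borel[OF f that(2)] by (simp add: h.scaleR h.zero)
  qed
  have "AE z in circle. h (f z) \<le> 0" if h: "bounded_linear h" for h :: "complex \<Rightarrow> real"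
    by (rule *[OF integrable_bounded_linear[OF h f(1)] Z[OF h]])
  from this[OF bounded_linear_Re] this[OF bounded_linear_Im]
    this[OF bounded_linear_minus[OF bounded_linear_Re]] this[OF bounded_linear_minus[OF bounded_linear_Im]]
  show ?thesis
    by eventually_elim (simp add: complex_eq_iff)
qed

section \<open>Calculating with representatives\<close>

lemma L2_cases:
  obtains f where "square_integrable f" "x = class_L2 f"
proof -
  have "\<exists>f. square_integrable f \<and> x = class_L2 f"
    by transfer (auto simp: L2_rel_def)
  then show thesis using that by blast
qed

lemma class_L2_eq_iff:
  assumes "square_integrable f" "square_integrable g"
  shows "class_L2 f = class_L2 g \<longleftrightarrow> (AE z in circle. f z = g z)"
  using assms by transfer (auto simp: L2_rel_def)

lemma class_L2_cong:
  assumes "square_integrable f" "\<And>z. norm z = 1 \<Longrightarrow> f z = g z"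
  shows "class_L2 f = class_L2 g"
proof -
  have eq: "f z = g z" if "z \<in> space circle" for z
    using assms(2) that by simp
  have "g \<in> borel_measurable circle \<longleftrightarrow> f \<in> borel_measurable circle"
    by (rule measurable_cong) (simp add: eq)
  moreover have "integrable circle (\<lambda>z. (norm (g z))\<^sup>2) \<longleftrightarrow> integrable circle (\<lambda>z. (norm (f z))\<^sup>2)"
    by (rule Bochner_Integration.integrable_cong) (simp_all add: eq)
  ultimately have "square_integrable g"
    using assms(1) by (simp add: square_integrable_def)
  then show ?thesis
    using assms(1) eq by (subst class_L2_eq_iff) (auto intro!: AE_I2)
qed

lemma class_L2_add:
  assumes "square_integrable f" "square_integrable g"
  shows "class_L2 (\<lambda>z. f z + g z) = class_L2 f + class_L2 g"
  using assms by transfer (auto simp: L2_rel_def square_integrable_add)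

lemma class_L2_scaleC:
  assumes "square_integrable f"
  shows "class_L2 (\<lambda>z. c * f z) = c *\<^sub>C class_L2 f"
  using assms by transfer (auto simp: L2_rel_def square_integrable_scale)

lemma class_L2_diff:
  assumes "square_integrable f" "square_integrable g"
  shows "class_L2 (\<lambda>z. f z - g z) = class_L2 f - class_L2 g"
proof -
  have "- class_L2 g = class_L2 (\<lambda>z. - 1 * g z)"
    using assms square_integrable_scale[of g "-1"]
    by transfer (auto simp: L2_rel_def)
  then show ?thesis
    using class_L2_add[OF assms(1) square_integrable_scale[OF assms(2), of "-1"]]
    by simp
qed

lemma square_integrable_diff:
  "square_integrable f \<Longrightarrow> square_integrable g \<Longrightarrow> square_integrable (\<lambda>z. f z - g z)"
  using square_integrable_add[of f "\<lambda>z. - 1 * g z"] square_integrable_scale[of g "-1"] by simp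

lemma mult_L2_class:
  assumes "\<phi> \<in> Linf" "square_integrable f"
  shows "mult_L2 \<phi> (class_L2 f) = class_L2 (\<lambda>z. \<phi> z * f z)"
  using assms by transfer (auto simp: L2_rel_def square_integrable_mult)

lemma flip_class:
  assumes "square_integrable f"
  shows "flip (class_L2 f) = class_L2 (\<lambda>z. f (cnj z))"
  using assms by transfer (auto simp: L2_rel_def square_integrable_cnj_arg)

lemma cinner_class:
  assumes "square_integrable f" "square_integrable g"
  shows "cinner (class_L2 f) (class_L2 g) = integral\<^sup>L circle (\<lambda>z. f z * cnj (g z))"
  using assms by transfer simp

lemma scaleC_add_right: "c *\<^sub>C (x + y) = c *\<^sub>C x + c *\<^sub>C y"
  by transfer (auto simp: L2_rel_def distrib_left square_integrable_add square_integrable_scale)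

lemma scaleC_add_left: "(c + d) *\<^sub>C x = c *\<^sub>C x + d *\<^sub>C x"
  by transfer (auto simp: L2_rel_def distrib_right square_integrable_add square_integrable_scale)

lemma scaleC_scaleC [simp]: "c *\<^sub>C d *\<^sub>C x = (c * d) *\<^sub>C x"
  by transfer (auto simp: L2_rel_def mult.assoc square_integrable_scale)

lemma scaleC_one [simp]: "1 *\<^sub>C x = x"
  by transfer (auto simp: L2_rel_def)

lemma scaleC_zero_left [simp]: "0 *\<^sub>C x = 0"
  by transfer (auto simp: L2_rel_def)

lemma scaleC_zero_right [simp]: "c *\<^sub>C (0::L2) = 0"
  by transfer (auto simp: L2_rel_def)

lemma scaleC_minus_left [simp]: "(- c) *\<^sub>C x = - (c *\<^sub>C x)"
  by transfer (auto simp: L2_rel_def square_integrable_scale dest: square_integrable_scale[where c = "- _"])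

lemma scaleC_minus_right [simp]: "c *\<^sub>C (- x) = - (c *\<^sub>C x)"
  by (metis add_eq_0_iff scaleC_add_right scaleC_zero_right add.right_inverse)

lemma scaleC_diff_right: "c *\<^sub>C (x - y) = c *\<^sub>C x - c *\<^sub>C y"
  by (simp only: diff_conv_add_uminus scaleC_add_right scaleC_minus_right)

lemma scaleC_diff_left: "(c - d) *\<^sub>C x = c *\<^sub>C x - d *\<^sub>C x"
  by (simp only: diff_conv_add_uminus scaleC_add_left scaleC_minus_left)

lemma cinner_zero_left [simp]: "cinner 0 x = 0"
  using cinner_scaleC_left[of 0 0 x] by simp

lemma cinner_zero_right [simp]: "cinner x 0 = 0"
  using cinner_commute[of x 0] by simp

lemma cinner_add_right: "cinner x (y + z) = cinner x y + cinner x z"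
  by (metis cinner_commute cinner_add_left complex_cnj_add)

lemma cinner_scaleC_right: "cinner x (c *\<^sub>C y) = cnj c * cinner x y"
  by (metis cinner_commute cinner_scaleC_left complex_cnj_mult)

lemma cinner_minus_left [simp]: "cinner (- x) y = - cinner x y"
  using cinner_add_left[of x "- x" y] by (simp add: eq_neg_iff_add_eq_0 add.commute)

lemma cinner_minus_right [simp]: "cinner x (- y) = - cinner x y"
  using cinner_add_right[of x y "- y"] by (simp add: eq_neg_iff_add_eq_0 add.commute)

lemma cinner_diff_left: "cinner (x - y) z = cinner x z - cinner y z"
  by (simp only: diff_conv_add_uminus cinner_add_left cinner_minus_left)

lemma cinner_diff_right: "cinner x (y - z) = cinner x y - cinner x z"
  by (simp only: diff_conv_add_uminus cinner_add_right cinner_minus_right)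

lemmas cinner_linear = cinner_add_left cinner_add_right cinner_scaleC_left cinner_scaleC_right
  cinner_diff_left cinner_diff_right

lemma cinner_self_eq: "cinner x x = of_real ((norm x)\<^sup>2)"
proof -
  have "Im (cinner x x) = 0" using cinner_commute[of x x] by (simp add: complex_eq_iff)
  moreover have "Re (cinner x x) = (norm x)\<^sup>2"
    unfolding power2_norm_eq_inner by (simp add: inner_L2_def)
  ultimately show ?thesis by (simp add: complex_eq_iff)
qed

lemma cinner_self_eq_0: "cinner x x = 0 \<longleftrightarrow> x = 0"
  by (simp add: cinner_self_eq)

lemma norm_scaleC: "norm (c *\<^sub>C x) = norm c * norm x"
proof -
  have "of_real ((norm (c *\<^sub>C x))\<^sup>2) = complex_of_real ((norm c * norm x)\<^sup>2)"
    unfolding cinner_self_eq[symmetric] cinner_scaleC_left cinner_scaleC_right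
    by (simp add: cinner_self_eq power_mult_distrib complex_norm_square del: of_real_power)
  then have "(norm (c *\<^sub>C x))\<^sup>2 = (norm c * norm x)\<^sup>2"
    by (simp only: of_real_eq_iff)
  then show ?thesis by (simp add: power2_eq_iff_nonneg)
qed

lemma norm_cinner_le: "norm (cinner x y) \<le> norm x * norm y"
proof -
  \<comment> \<open>rotating \<open>x\<close> by \<open>w\<close> makes the inner product real, so that the real Cauchy-Schwarz inequality applies\<close>
  define w where "w = (if cinner x y = 0 then 1 else cnj (cinner x y) / norm (cinner x y))"
  have w: "norm w = 1" by (simp add: w_def norm_divide)
  have "w * cinner x y = of_real (norm (cinner x y))"
    by (simp add: w_def mult.commute complex_norm_square[symmetric] power2_eq_square)
  then have "norm (cinner x y) = inner (w *\<^sub>C x) y"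
    by (simp add: inner_L2_def cinner_scaleC_left)
  also have "\<dots> \<le> norm (w *\<^sub>C x) * norm y" by (rule norm_cauchy_schwarz)
  finally show ?thesis using w by (simp add: norm_scaleC)
qed

lemma bounded_linear_cinner_left: "bounded_linear (\<lambda>x. cinner x y)"
  by (rule bounded_linear_intro[where K = "norm y"])
     (auto simp: cinner_add_left scaleR_L2_def cinner_scaleC_left scaleR_conv_of_real norm_cinner_le)

lemma continuous_on_cinner_left [continuous_intros]:
  "continuous_on S f \<Longrightarrow> continuous_on S (\<lambda>x. cinner (f x) y)"
  by (rule bounded_linear.continuous_on[OF bounded_linear_cinner_left])

definition bounded_clinear :: "(L2 \<Rightarrow> L2) \<Rightarrow> bool" where
  "bounded_clinear T \<longleftrightarrow> bounded_linear T \<and> (\<forall>c x. T (c *\<^sub>C x) = c *\<^sub>C T x)"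

lemma bounded_clinearI:
  assumes "\<And>x y. T (x + y) = T x + T y" "\<And>c x. T (c *\<^sub>C x) = c *\<^sub>C T x"
    and "\<And>x. norm (T x) \<le> B * norm x"
  shows "bounded_clinear T"
  unfolding bounded_clinear_def
  using assms by (auto simp: scaleR_L2_def mult.commute intro!: bounded_linear_intro[where K = B])

lemma bounded_clinear_bounded_linear: "bounded_clinear T \<Longrightarrow> bounded_linear T"
  by (simp add: bounded_clinear_def)

lemma bounded_clinear_scaleC: "bounded_clinear T \<Longrightarrow> T (c *\<^sub>C x) = c *\<^sub>C T x"
  by (simp add: bounded_clinear_def)

lemma bounded_clinear_add: "bounded_clinear T \<Longrightarrow> T (x + y) = T x + T y"
  unfolding bounded_clinear_def by (metis bounded_linear.linear linear_add)

lemma bounded_clinear_diff: "bounded_clinear T \<Longrightarrow> T (x - y) = T x - T y"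
  unfolding bounded_clinear_def by (metis bounded_linear.linear linear_diff)

lemma bounded_clinear_zero: "bounded_clinear T \<Longrightarrow> T 0 = 0"
  unfolding bounded_clinear_def by (metis bounded_linear.linear linear_0)

lemmas bounded_clinear_rules =
  bounded_clinear_scaleC bounded_clinear_add bounded_clinear_diff bounded_clinear_zero

lemma bounded_clinear_compose:
  "bounded_clinear S \<Longrightarrow> bounded_clinear T \<Longrightarrow> bounded_clinear (\<lambda>x. S (T x))"
  unfolding bounded_clinear_def by (auto intro: bounded_linear_compose)

lemma bounded_clinear_diff_fun:
  "bounded_clinear S \<Longrightarrow> bounded_clinear T \<Longrightarrow> bounded_clinear (\<lambda>x. S x - T x)"
  unfolding bounded_clinear_def by (auto intro: bounded_linear_sub simp: scaleC_diff_right)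

lemma bounded_clinear_ident: "bounded_clinear (\<lambda>x. x)"
  unfolding bounded_clinear_def by auto

section \<open>Multiplication operators and the flip\<close>

lemma Linf_cnj: "\<phi> \<in> Linf \<Longrightarrow> (\<lambda>z. cnj (\<phi> z)) \<in> Linf"
  by (auto simp: Linf_def)

lemma Linf_mult: "\<phi> \<in> Linf \<Longrightarrow> \<psi> \<in> Linf \<Longrightarrow> (\<lambda>z. \<phi> z * \<psi> z) \<in> Linf"
proof -
  assume *: "\<phi> \<in> Linf" "\<psi> \<in> Linf"
  then obtain B C where B: "AE z in circle. norm (\<phi> z) \<le> B" "AE z in circle. norm (\<psi> z) \<le> C"
    by (auto simp: Linf_def)
  from B have "AE z in circle. norm (\<phi> z * \<psi> z) \<le> B * C"
    by eventually_elim (auto simp: norm_mult intro!: mult_mono intro: order_trans[OF norm_ge_zero])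
  with * show ?thesis by (auto simp: Linf_def)
qed

lemma Linf_flip: "\<phi> \<in> Linf \<Longrightarrow> (\<lambda>z. \<phi> (cnj z)) \<in> Linf"
  using AE_circle_cnj[of "\<lambda>z. norm (\<phi> z) \<le> _"]
  by (auto simp: Linf_def borel_measurable_circle_cnj_arg)

lemma Linf_const [simp]: "(\<lambda>_. c) \<in> Linf"
  by (auto simp: Linf_def)

lemma Linf_add: "\<phi> \<in> Linf \<Longrightarrow> \<psi> \<in> Linf \<Longrightarrow> (\<lambda>z. \<phi> z + \<psi> z) \<in> Linf"
proof -
  assume *: "\<phi> \<in> Linf" "\<psi> \<in> Linf"
  then obtain B C where B: "AE z in circle. norm (\<phi> z) \<le> B" "AE z in circle. norm (\<psi> z) \<le> C"
    by (auto simp: Linf_def)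
  from B have "AE z in circle. norm (\<phi> z + \<psi> z) \<le> B + C"
    by eventually_elim (auto intro: norm_triangle_le add_mono)
  with * show ?thesis by (auto simp: Linf_def)
qed

lemma Linf_continuous:
  assumes "continuous_on (sphere 0 1) g"
  shows "g \<in> Linf"
proof -
  have "compact (g ` sphere 0 1)"
    using assms by (rule compact_continuous_image) simp
  then obtain B where B: "\<forall>x\<in>g ` sphere 0 1. norm x \<le> B"
    using compact_imp_bounded bounded_iff by metis
  have "AE z in circle. norm (g z) \<le> B"
    using AE_circle_sphere by eventually_elim (use B in auto)
  then show ?thesis
    using borel_measurable_circle_continuous[OF assms] by (auto simp: Linf_def)
qed

lemma Linf_id [simp]: "(\<lambda>z. z) \<in> Linf"
  by (rule Linf_continuous) (auto intro!: continuous_intros)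

lemma Linf_cnj_id [simp]: "cnj \<in> Linf"
  by (rule Linf_continuous) (auto intro!: continuous_intros)

lemma Linf_powi [simp]: "(\<lambda>z. z powi n) \<in> Linf"
  by (rule Linf_continuous) (auto intro!: continuous_intros)

lemma square_integrable_Linf: "\<phi> \<in> Linf \<Longrightarrow> square_integrable \<phi>"
  using square_integrable_mult[of \<phi> "\<lambda>_. 1"] by (simp add: square_integrable_def)

lemma norm_class_L2:
  assumes "square_integrable f"
  shows "(norm (class_L2 f))\<^sup>2 = integral\<^sup>L circle (\<lambda>z. (norm (f z))\<^sup>2)"
proof -
  have "complex_of_real ((norm (class_L2 f))\<^sup>2) = of_real (integral\<^sup>L circle (\<lambda>z. (norm (f z))\<^sup>2))"
    using assms by (simp only: cinner_self_eq[symmetric] cinner_class cinner_self)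
  then show ?thesis by (simp only: of_real_eq_iff)
qed

lemma bounded_clinear_mult_L2:
  assumes "\<phi> \<in> Linf"
  shows "bounded_clinear (mult_L2 \<phi>)"
proof -
  obtain B where B: "AE z in circle. norm (\<phi> z) \<le> B"
    using assms by (auto simp: Linf_def)
  show ?thesis
  proof (rule bounded_clinearI)
    fix x y :: L2 and c :: complex
    obtain f where f: "square_integrable f" "x = class_L2 f" by (rule L2_cases)
    obtain g where g: "square_integrable g" "y = class_L2 g" by (rule L2_cases)
    note si = square_integrable_add square_integrable_scale square_integrable_mult
    show "mult_L2 \<phi> (x + y) = mult_L2 \<phi> x + mult_L2 \<phi> y"
      using f g assms by (simp add: mult_L2_class si distrib_left flip: class_L2_add)
    show "mult_L2 \<phi> (c *\<^sub>C x) = c *\<^sub>C mult_L2 \<phi> x"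
      using f assms by (simp add: mult_L2_class si mult.left_commute flip: class_L2_scaleC)
    have "integral\<^sup>L circle (\<lambda>z. (norm (\<phi> z * f z))\<^sup>2) \<le> integral\<^sup>L circle (\<lambda>z. \<bar>B\<bar>\<^sup>2 * (norm (f z))\<^sup>2)"
    proof (rule integral_mono_AE)
      show "integrable circle (\<lambda>z. (norm (\<phi> z * f z))\<^sup>2)" "integrable circle (\<lambda>z. \<bar>B\<bar>\<^sup>2 * (norm (f z))\<^sup>2)"
        using si(3)[OF assms f(1)] f(1) by (auto simp: square_integrable_def)
      show "AE z in circle. (norm (\<phi> z * f z))\<^sup>2 \<le> \<bar>B\<bar>\<^sup>2 * (norm (f z))\<^sup>2"
        using B
      proof eventually_elim
        case (elim z)
        then have "norm (\<phi> z) \<le> \<bar>B\<bar>" by simp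
        then show ?case
          unfolding norm_mult power_mult_distrib
          by (intro mult_right_mono power_mono) auto
      qed
    qed
    also have "\<dots> = \<bar>B\<bar>\<^sup>2 * (norm x)\<^sup>2" using f by (simp add: norm_class_L2)
    finally have "(norm (mult_L2 \<phi> x))\<^sup>2 \<le> (\<bar>B\<bar> * norm x)\<^sup>2"
      using f assms by (simp add: mult_L2_class norm_class_L2 si power_mult_distrib)
    then show "norm (mult_L2 \<phi> x) \<le> \<bar>B\<bar> * norm x"
      by (rule power2_le_imp_le) simp
  qed
qed

lemma mult_L2_mult_L2:
  assumes "\<phi> \<in> Linf" "\<psi> \<in> Linf"
  shows "mult_L2 \<phi> (mult_L2 \<psi> x) = mult_L2 (\<lambda>z. \<phi> z * \<psi> z) x"
  by (cases x rule: L2_cases)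
     (simp add: mult_L2_class assms square_integrable_mult Linf_mult mult.assoc)

lemma mult_L2_commute:
  assumes "\<phi> \<in> Linf" "\<psi> \<in> Linf"
  shows "mult_L2 \<phi> (mult_L2 \<psi> x) = mult_L2 \<psi> (mult_L2 \<phi> x)"
  using assms by (simp add: mult_L2_mult_L2 mult.commute)

lemma mult_L2_cong_AE:
  assumes "\<phi> \<in> Linf" "\<psi> \<in> Linf" "AE z in circle. \<phi> z = \<psi> z"
  shows "mult_L2 \<phi> x = mult_L2 \<psi> x"
proof (cases x rule: L2_cases)
  case (1 f)
  have "AE z in circle. \<phi> z * f z = \<psi> z * f z"
    using assms(3) by eventually_elim simp
  with 1 assms show ?thesis
    by (simp add: mult_L2_class class_L2_eq_iff square_integrable_mult)
qed

lemma mult_L2_one [simp]: "mult_L2 (\<lambda>_. 1) x = x"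
  by (cases x rule: L2_cases) (simp add: mult_L2_class)

lemma mult_L2_cnj_cancel:
  assumes "\<phi> \<in> Linf" "AE z in circle. norm (\<phi> z) = 1"
  shows "mult_L2 (\<lambda>z. cnj (\<phi> z)) (mult_L2 \<phi> x) = x"
    and "mult_L2 \<phi> (mult_L2 (\<lambda>z. cnj (\<phi> z)) x) = x"
proof -
  have "AE z in circle. cnj (\<phi> z) * \<phi> z = 1"
    using assms(2)
    by eventually_elim (simp add: mult.commute[of "cnj _"] complex_norm_square[symmetric])
  then have "mult_L2 (\<lambda>z. cnj (\<phi> z) * \<phi> z) x = mult_L2 (\<lambda>_. 1) x"
    using assms(1) by (intro mult_L2_cong_AE) (simp_all add: Linf_mult Linf_cnj)
  then show *: "mult_L2 (\<lambda>z. cnj (\<phi> z)) (mult_L2 \<phi> x) = x"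
    using assms(1) by (simp add: mult_L2_mult_L2 Linf_cnj)
  then show "mult_L2 \<phi> (mult_L2 (\<lambda>z. cnj (\<phi> z)) x) = x"
    using assms(1) by (simp add: mult_L2_commute Linf_cnj)
qed

lemma cinner_mult_L2_left:
  assumes "\<phi> \<in> Linf"
  shows "cinner (mult_L2 \<phi> x) y = cinner x (mult_L2 (\<lambda>z. cnj (\<phi> z)) y)"
proof -
  obtain f where f: "square_integrable f" "x = class_L2 f" by (rule L2_cases)
  obtain g where g: "square_integrable g" "y = class_L2 g" by (rule L2_cases)
  note si = square_integrable_mult[OF assms f(1)] square_integrable_mult[OF Linf_cnj[OF assms] g(1)]
  show ?thesis
    unfolding f(2) g(2) mult_L2_class[OF assms f(1)] mult_L2_class[OF Linf_cnj[OF assms] g(1)]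
      cinner_class[OF si(1) g(1)] cinner_class[OF f(1) si(2)]
    by (simp add: mult_ac)
qed

lemma cinner_mult_L2_right:
  assumes "\<phi> \<in> Linf"
  shows "cinner x (mult_L2 \<phi> y) = cinner (mult_L2 (\<lambda>z. cnj (\<phi> z)) x) y"
  using cinner_mult_L2_left[OF Linf_cnj[OF assms], of x y] by simp

lemma integral_circle_cnj_arg:
  fixes f :: "complex \<Rightarrow> complex"
  assumes "f \<in> borel_measurable circle"
  shows "integral\<^sup>L circle (\<lambda>z. f (cnj z)) = integral\<^sup>L circle f"
  using integral_distr[OF measurable_cnj_circle assms] by (simp add: distr_circle_cnj)

lemma flip_flip [simp]: "flip (flip x) = x"
  by (cases x rule: L2_cases) (simp add: flip_class square_integrable_cnj_arg)

lemma cinner_flip_left: "cinner (flip x) y = cinner x (flip y)"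
proof -
  obtain f where f: "square_integrable f" "x = class_L2 f" by (rule L2_cases)
  obtain g where g: "square_integrable g" "y = class_L2 g" by (rule L2_cases)
  have [measurable]: "f \<in> borel_measurable circle" "g \<in> borel_measurable circle"
    "(\<lambda>z. g (cnj z)) \<in> borel_measurable circle"
    using f g by (auto simp: square_integrable_def borel_measurable_circle_cnj_arg)
  have "integral\<^sup>L circle (\<lambda>z. f (cnj z) * cnj (g z)) = integral\<^sup>L circle (\<lambda>z. f z * cnj (g (cnj z)))"
    using integral_circle_cnj_arg[of "\<lambda>z. f z * cnj (g (cnj z))"] by simp
  with f g show ?thesis
    by (simp add: flip_class cinner_class square_integrable_cnj_arg)
qed

lemma bounded_clinear_flip: "bounded_clinear flip"
proof (rule bounded_clinearI[where B = 1])
  fix x y :: L2 and c :: complex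
  obtain f where f: "square_integrable f" "x = class_L2 f" by (rule L2_cases)
  obtain g where g: "square_integrable g" "y = class_L2 g" by (rule L2_cases)
  note si = square_integrable_add square_integrable_scale square_integrable_cnj_arg
  show "flip (x + y) = flip x + flip y"
    using f g by (simp add: flip_class si flip: class_L2_add)
  show "flip (c *\<^sub>C x) = c *\<^sub>C flip x"
    using f by (simp add: flip_class si flip: class_L2_scaleC)
  have "complex_of_real ((norm (flip x))\<^sup>2) = of_real ((norm x)\<^sup>2)"
    unfolding cinner_self_eq[symmetric] cinner_flip_left by simp
  then have "(norm (flip x))\<^sup>2 = (norm x)\<^sup>2" by (simp only: of_real_eq_iff)
  then show "norm (flip x) \<le> 1 * norm x" by (simp add: power2_eq_iff_nonneg)
qed

lemma flip_mult_L2: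
  assumes "\<phi> \<in> Linf"
  shows "flip (mult_L2 \<phi> x) = mult_L2 (\<lambda>z. \<phi> (cnj z)) (flip x)"
  by (cases x rule: L2_cases)
     (simp add: flip_class mult_L2_class assms square_integrable_mult square_integrable_cnj_arg Linf_flip)

section \<open>Completeness of \<open>L\<^sup>2\<close>\<close>

text \<open>A fast Cauchy sequence of functions converges almost everywhere: the absolute value \<open>d\<close> of
  its \<open>k\<close>-th increment satisfies \<open>d \<le> (1/2) ^ k + 2 ^ k * d\<^sup>2\<close>, so the sum of the increments has
  finite integral. Fatou's lemma then gives convergence in norm.\<close>

lemma fast_Cauchy_L2_converges:
  fixes X :: "nat \<Rightarrow> L2"
  assumes fast: "\<And>m n. m \<le> n \<Longrightarrow> norm (X n - X m) \<le> (1/2) ^ m"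
  shows "\<exists>x. \<forall>m. norm (x - X m) \<le> (1/2) ^ m"
proof -
  have "\<exists>f. square_integrable f \<and> X n = class_L2 f" for n
    using L2_cases[of "X n"] by blast
  then obtain F where F: "\<And>n. square_integrable (F n)" "\<And>n. X n = class_L2 (F n)"
    by metis
  note diff = square_integrable_diff[OF F(1) F(1)]
  have [measurable]: "F n \<in> borel_measurable circle" for n
    using F by (simp add: square_integrable_def)
  have nn: "(\<integral>\<^sup>+z. ennreal ((norm (F n z - F m z))\<^sup>2) \<partial>circle) \<le> ennreal (((1/2) ^ m)\<^sup>2)"
    if "m \<le> n" for m n
  proof -
    have "(\<integral>\<^sup>+z. ennreal ((norm (F n z - F m z))\<^sup>2) \<partial>circle) =
        ennreal (integral\<^sup>L circle (\<lambda>z. (norm (F n z - F m z))\<^sup>2))"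
      using diff[of n m] by (intro nn_integral_eq_integral) (auto simp: square_integrable_def)
    also have "\<dots> = ennreal ((norm (X n - X m))\<^sup>2)"
      by (simp add: F class_L2_diff[symmetric] norm_class_L2[OF diff])
    also have "\<dots> \<le> ennreal (((1/2) ^ m)\<^sup>2)"
      using fast[OF that] by (intro ennreal_leI power_mono) auto
    finally show ?thesis .
  qed
  define d where "d k z = norm (F (Suc k) z - F k z)" for k z
  have [measurable]: "d k \<in> borel_measurable circle" for k unfolding d_def by measurable
  have dk: "(\<integral>\<^sup>+z. ennreal (d k z) \<partial>circle) \<le> ennreal (2 * (1/2) ^ k)" for k
  proof -
    have "d k z \<le> (1/2) ^ k + 2 ^ k * (d k z)\<^sup>2" for z
    proof (cases "d k z \<le> (1/2) ^ k")
      case False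
      then have "1 \<le> 2 ^ k * d k z" by (simp add: field_simps power_one_over)
      then have "1 * d k z \<le> 2 ^ k * d k z * d k z"
        by (intro mult_right_mono) (auto simp: d_def)
      moreover have "(0::real) \<le> (1/2) ^ k" by simp
      ultimately show ?thesis unfolding power2_eq_square mult.assoc by linarith
    qed (simp add: add_increasing2)
    then have "(\<integral>\<^sup>+z. ennreal (d k z) \<partial>circle) \<le>
        (\<integral>\<^sup>+z. ennreal ((1/2) ^ k) + ennreal (2 ^ k) * ennreal ((d k z)\<^sup>2) \<partial>circle)"
      by (intro nn_integral_mono)
         (simp add: ennreal_mult[symmetric] ennreal_plus[symmetric] ennreal_leI del: ennreal_plus)
    also have "\<dots> = ennreal ((1/2) ^ k) + ennreal (2 ^ k) * (\<integral>\<^sup>+z. ennreal ((d k z)\<^sup>2) \<partial>circle)"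
      using emeasure_circle_space by (subst nn_integral_add) (auto simp: nn_integral_cmult)
    also have "\<dots> \<le> ennreal ((1/2) ^ k) + ennreal (2 ^ k) * ennreal (((1/2) ^ k)\<^sup>2)"
      unfolding d_def by (intro add_left_mono mult_left_mono nn) auto
    also have "\<dots> = ennreal ((1/2) ^ k + 2 ^ k * ((1/2) ^ k)\<^sup>2)"
      by (simp add: ennreal_mult[symmetric] ennreal_plus[symmetric] del: ennreal_plus)
    also have "(1/2) ^ k + 2 ^ k * ((1/2) ^ k)\<^sup>2 = 2 * (1/2 :: real) ^ k"
      by (simp add: power2_eq_square power_one_over)
    finally show ?thesis .
  qed
  have "(\<integral>\<^sup>+z. (\<Sum>k. ennreal (d k z)) \<partial>circle) = (\<Sum>k. \<integral>\<^sup>+z. ennreal (d k z) \<partial>circle)"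
    by (rule nn_integral_suminf) auto
  also have "\<dots> \<le> (\<Sum>k. ennreal (2 * (1/2) ^ k))"
    by (intro suminf_le dk) auto
  also have "\<dots> = ennreal (\<Sum>k. 2 * (1/2) ^ k)"
    by (intro suminf_ennreal2) (auto intro!: summable_mult summable_geometric)
  also have "\<dots> < \<infinity>" by simp
  finally have "AE z in circle. (\<Sum>k. ennreal (d k z)) \<noteq> \<infinity>"
    by (intro nn_integral_PInf_AE) auto
  then have "AE z in circle. convergent (\<lambda>n. F n z)"
  proof eventually_elim
    case (elim z)
    then have "summable (\<lambda>k. d k z)"
      by (intro summable_suminf_not_top) (auto simp: d_def)
    then have "summable (\<lambda>k. F (Suc k) z - F k z)"
      unfolding d_def by (rule summable_norm_cancel)
    then have "convergent (\<lambda>n. \<Sum>k<n. F (Suc k) z - F k z)"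
      by (simp add: summable_iff_convergent)
    then have "convergent (\<lambda>n. F 0 z + (F n z - F 0 z))"
      unfolding sum_lessThan_telescope[of "\<lambda>k. F k z"] by (rule convergent_add[OF convergent_const])
    then show ?case by simp
  qed
  then have lim: "AE z in circle. (\<lambda>n. F n z) \<longlonglongrightarrow> lim (\<lambda>n. F n z)"
    by eventually_elim (simp add: convergent_LIMSEQ_iff)
  define f where "f z = lim (\<lambda>n. F n z)" for z
  have [measurable]: "f \<in> borel_measurable circle"
    unfolding f_def by (rule borel_measurable_lim_metric) simp
  have fm: "(\<integral>\<^sup>+z. ennreal ((norm (f z - F m z))\<^sup>2) \<partial>circle) \<le> ennreal (((1/2) ^ m)\<^sup>2)" for m
  proof -
    have "(\<integral>\<^sup>+z. ennreal ((norm (f z - F m z))\<^sup>2) \<partial>circle) =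
        (\<integral>\<^sup>+z. liminf (\<lambda>n. ennreal ((norm (F n z - F m z))\<^sup>2)) \<partial>circle)"
    proof (rule nn_integral_cong_AE)
      show "AE z in circle. ennreal ((norm (f z - F m z))\<^sup>2) =
          liminf (\<lambda>n. ennreal ((norm (F n z - F m z))\<^sup>2))"
        using lim
      proof eventually_elim
        case (elim z)
        then have "(\<lambda>n. ennreal ((norm (F n z - F m z))\<^sup>2)) \<longlonglongrightarrow> ennreal ((norm (f z - F m z))\<^sup>2)"
          unfolding f_def by (intro tendsto_intros)
        then show ?case by (rule lim_imp_Liminf[OF sequentially_bot, symmetric])
      qed
    qed
    also have "\<dots> \<le> liminf (\<lambda>n. \<integral>\<^sup>+z. ennreal ((norm (F n z - F m z))\<^sup>2) \<partial>circle)"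
      by (rule nn_integral_liminf) auto
    also have "\<dots> \<le> liminf (\<lambda>n::nat. ennreal (((1/2) ^ m)\<^sup>2))"
      using nn by (intro Liminf_mono eventually_sequentiallyI[of m]) auto
    also have "\<dots> = ennreal (((1/2) ^ m)\<^sup>2)"
      by (simp add: Liminf_const)
    finally show ?thesis .
  qed
  have si: "square_integrable (\<lambda>z. f z - F m z)" for m
    unfolding square_integrable_def
  proof (intro conjI integrableI_bounded)
    show "(\<integral>\<^sup>+z. ennreal (norm ((norm (f z - F m z))\<^sup>2)) \<partial>circle) < \<infinity>"
      using le_less_trans[OF fm[of m] ennreal_less_top] by simp
  qed auto
  then have sf: "square_integrable f"
    using square_integrable_add[OF si F(1), of 0 0] by simp
  have "norm (class_L2 f - X m) \<le> (1/2) ^ m" for m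
  proof -
    have "ennreal ((norm (class_L2 f - X m))\<^sup>2) = ennreal (integral\<^sup>L circle (\<lambda>z. (norm (f z - F m z))\<^sup>2))"
      by (simp add: F class_L2_diff[symmetric] sf norm_class_L2[OF si])
    also have "\<dots> = (\<integral>\<^sup>+z. ennreal ((norm (f z - F m z))\<^sup>2) \<partial>circle)"
      using si[of m] by (intro nn_integral_eq_integral[symmetric]) (auto simp: square_integrable_def)
    also have "\<dots> \<le> ennreal (((1/2) ^ m)\<^sup>2)" by (rule fm)
    finally have "(norm (class_L2 f - X m))\<^sup>2 \<le> ((1/2) ^ m)\<^sup>2" by (simp del: power_one_over)
    then show ?thesis by (rule power2_le_imp_le) simp
  qed
  then show ?thesis by blast
qed

instance L2 :: complete_space
proof
  fix X :: "nat \<Rightarrow> L2" assume X: "Cauchy X"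
  have "\<exists>M. \<forall>m\<ge>M. \<forall>n\<ge>M. dist (X m) (X n) < (1/2) ^ k" for k :: nat
    using X unfolding Cauchy_def by simp
  then obtain M where M: "\<And>k m n. m \<ge> M k \<Longrightarrow> n \<ge> M k \<Longrightarrow> dist (X m) (X n) < (1/2) ^ k"
    by metis
  \<comment> \<open>taking the maximum makes the chosen indices increasing, so that the subsequence is fast Cauchy\<close>
  define N where "N k = Max (M ` {..k})" for k
  have N: "M j \<le> N k" if "j \<le> k" for j k
    unfolding N_def using that by (intro Max_ge) auto
  have "norm (X (N n) - X (N m)) \<le> (1/2) ^ m" if "m \<le> n" for m n
    using M[of m "N n" "N m"] N[of m n] N[of m m] that by (simp add: dist_norm)
  then obtain x where x: "\<And>m. norm (x - X (N m)) \<le> (1/2) ^ m"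
    using fast_Cauchy_L2_converges[of "\<lambda>k. X (N k)"] by blast
  have "X \<longlonglongrightarrow> x"
  proof (rule LIMSEQ_I)
    fix e :: real assume "e > 0"
    then obtain k where k: "(1/2) ^ k < e / 2"
      using real_arch_pow_inv[of "e/2" "1/2"] by auto
    have "norm (X n - x) < e" if "n \<ge> M k" for n
    proof -
      have "norm (X n - x) \<le> norm (X n - X (N k)) + norm (x - X (N k))"
        using norm_triangle_ineq4[of "X n - X (N k)" "x - X (N k)"] by simp
      also have "\<dots> < e"
        using M[OF that N[OF order_refl]] x[of k] k by (simp add: dist_norm)
      finally show ?thesis .
    qed
    then show "\<exists>no. \<forall>n\<ge>no. norm (X n - x) < e" by blast
  qed
  then show "convergent X" by (auto simp: convergent_def)
qed

section \<open>Orthogonal projections and the Riesz representation\<close>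

definition csubspace :: "L2 set \<Rightarrow> bool" where
  "csubspace M \<longleftrightarrow> 0 \<in> M \<and> (\<forall>x\<in>M. \<forall>y\<in>M. x + y \<in> M) \<and> (\<forall>c. \<forall>x\<in>M. c *\<^sub>C x \<in> M)"

lemma csubspace_diff: "csubspace M \<Longrightarrow> x \<in> M \<Longrightarrow> y \<in> M \<Longrightarrow> x - y \<in> M"
  unfolding csubspace_def
  by (metis diff_conv_add_uminus scaleC_minus_left scaleC_one)

lemma bounded_clinear_kernel:
  assumes "bounded_clinear T"
  shows "csubspace {x. T x = 0}" "closed {x. T x = 0}"
proof -
  show "csubspace {x. T x = 0}"
    using assms by (auto simp: csubspace_def bounded_clinear_rules)
  show "closed {x. T x = 0}"
    using assms bounded_clinear_bounded_linear linear_continuous_on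
    by (intro closed_Collect_eq) auto
qed

text \<open>The nearest point of a closed subspace exists because a minimizing sequence is Cauchy by the
  parallelogram law. The residual is orthogonal to the subspace: otherwise subtracting
  its component along a vector of the subspace would shorten it.\<close>

theorem projection_theorem:
  assumes M: "csubspace M" "closed M"
  shows "\<exists>p\<in>M. \<forall>v\<in>M. cinner (x - p) v = 0"
proof -
  define d where "d = (INF y\<in>M. (norm (x - y))\<^sup>2)"
  have M0: "0 \<in> M" and Madd: "\<And>x y. x \<in> M \<Longrightarrow> y \<in> M \<Longrightarrow> x + y \<in> M"
    and Msc: "\<And>c x. x \<in> M \<Longrightarrow> c *\<^sub>C x \<in> M"
    using M by (auto simp: csubspace_def)
  have bdd: "bdd_below ((\<lambda>y. (norm (x - y))\<^sup>2) ` M)"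
    by (rule bdd_belowI[of _ 0]) auto
  have d: "d \<le> (norm (x - y))\<^sup>2" if "y \<in> M" for y
    unfolding d_def by (rule cINF_lower[OF bdd that])
  have "\<exists>y\<in>M. (norm (x - y))\<^sup>2 < d + inverse (real (Suc n))" for n
    using cINF_less_iff[OF _ bdd, of "d + inverse (real (Suc n))"] M0 by (auto simp: d_def)
  then obtain Y where Y: "\<And>n. Y n \<in> M" "\<And>n. (norm (x - Y n))\<^sup>2 < d + inverse (real (Suc n))"
    by metis
  have diff: "(norm (Y m - Y n))\<^sup>2 \<le> 2 * inverse (real (Suc m)) + 2 * inverse (real (Suc n))" for m n
  proof -
    have mid: "(1/2) *\<^sub>R (Y m + Y n) \<in> M"
      unfolding scaleR_L2_def by (intro Msc Madd Y)
    have "(norm (Y m - Y n))\<^sup>2 =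
        2 * (norm (x - Y m))\<^sup>2 + 2 * (norm (x - Y n))\<^sup>2 - 4 * (norm (x - (1/2) *\<^sub>R (Y m + Y n)))\<^sup>2"
      unfolding power2_norm_eq_inner
      by (simp add: inner_diff inner_add inner_commute algebra_simps)
    then show ?thesis using d[OF mid] Y(2)[of m] Y(2)[of n] by linarith
  qed
  have "Cauchy Y"
  proof (rule metric_CauchyI)
    fix e :: real assume e: "e > 0"
    obtain N where N: "inverse (real (Suc N)) < e\<^sup>2 / 4"
      using e reals_Archimedean[of "e\<^sup>2 / 4"] by auto
    have "dist (Y m) (Y n) < e" if "m \<ge> N" "n \<ge> N" for m n
    proof -
      have "inverse (real (Suc m)) \<le> inverse (real (Suc N))"
        "inverse (real (Suc n)) \<le> inverse (real (Suc N))"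
        using that by auto
      then have "(norm (Y m - Y n))\<^sup>2 < e\<^sup>2"
        using diff[of m n] N by linarith
      then show ?thesis
        using e by (simp add: dist_norm power2_less_imp_less)
    qed
    then show "\<exists>N. \<forall>m\<ge>N. \<forall>n\<ge>N. dist (Y m) (Y n) < e" by blast
  qed
  then obtain p where p: "Y \<longlonglongrightarrow> p"
    using Cauchy_convergent convergent_def by blast
  have pM: "p \<in> M"
    using closed_sequentially[OF M(2) _ p] Y(1) by blast
  have le: "(norm (x - p))\<^sup>2 \<le> d"
  proof (rule LIMSEQ_le)
    show "(\<lambda>n. (norm (x - Y n))\<^sup>2) \<longlonglongrightarrow> (norm (x - p))\<^sup>2"
      by (intro tendsto_intros p)
    show "(\<lambda>n. d + inverse (real (Suc n))) \<longlonglongrightarrow> d"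
      using tendsto_add[OF tendsto_const LIMSEQ_inverse_real_of_nat, of d] by simp
    show "\<exists>N. \<forall>n\<ge>N. (norm (x - Y n))\<^sup>2 \<le> d + inverse (real (Suc n))"
      using Y(2) less_imp_le by blast
  qed
  have "cinner (x - p) v = 0" if v: "v \<in> M" for v
  proof (rule ccontr)
    define c where "c = cinner (x - p) v"
    assume "cinner (x - p) v \<noteq> 0"
    then have c: "c \<noteq> 0" by (simp add: c_def)
    then have v0: "v \<noteq> 0" by (auto simp: c_def)
    \<comment> \<open>\<open>w\<close> is the projection of \<open>x - p\<close> onto the line through \<open>v\<close>\<close>
    define s where "s = inverse ((norm v)\<^sup>2)"
    define w where "w = (of_real s * c) *\<^sub>C v"
    have s: "s * (norm v)\<^sup>2 = 1" "s > 0" using v0 by (auto simp: s_def)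
    have "p + w \<in> M" unfolding w_def by (intro Madd pM Msc v)
    then have "(norm (x - p))\<^sup>2 \<le> (norm ((x - p) - w))\<^sup>2"
      using d le by (metis diff_diff_eq order_trans)
    also have "\<dots> = (norm (x - p))\<^sup>2 - 2 * Re (cinner (x - p) w) + (norm w)\<^sup>2"
      unfolding power2_norm_eq_inner by (simp add: inner_diff inner_commute inner_L2_def[symmetric])
    also have "Re (cinner (x - p) w) = s * (norm c)\<^sup>2"
      unfolding w_def cinner_scaleC_right c_def[symmetric] cmod_power2
      by (simp add: power2_eq_square algebra_simps)
    also have "(norm w)\<^sup>2 = s * (norm c)\<^sup>2 * (s * (norm v)\<^sup>2)"
      using s(2) by (simp add: w_def norm_scaleC norm_mult power2_eq_square)
    finally have "s * (norm c)\<^sup>2 \<le> 0" using s by simp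
    then show False using s c by (simp add: mult_le_0_iff)
  qed
  then show ?thesis using pM by blast
qed

lemma projection_unique:
  assumes "csubspace M" "p \<in> M" "\<forall>v\<in>M. cinner (x - p) v = 0" "q \<in> M" "\<forall>v\<in>M. cinner (x - q) v = 0"
  shows "p = q"
proof -
  have "p - q \<in> M" using assms csubspace_diff by blast
  then have "cinner (x - q) (p - q) - cinner (x - p) (p - q) = 0" using assms by simp
  then have "cinner (p - q) (p - q) = 0" by (simp flip: cinner_diff_left)
  then show ?thesis by (simp add: cinner_self_eq_0)
qed

lemma orth_proj_eqI:
  assumes "csubspace M" "p \<in> M" "\<And>v. v \<in> M \<Longrightarrow> cinner (x - p) v = 0"
  shows "orth_proj M x = p"
  unfolding orth_proj_def
  using assms by (intro the_equality) (auto intro: projection_unique[OF assms(1)])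

lemma orth_proj:
  assumes "csubspace M" "closed M"
  shows "orth_proj M x \<in> M" "\<And>v. v \<in> M \<Longrightarrow> cinner (x - orth_proj M x) v = 0"
proof -
  obtain p where "p \<in> M" "\<forall>v\<in>M. cinner (x - p) v = 0"
    using projection_theorem[OF assms] by blast
  moreover from this have "orth_proj M x = p" by (intro orth_proj_eqI assms) auto
  ultimately show "orth_proj M x \<in> M" "\<And>v. v \<in> M \<Longrightarrow> cinner (x - orth_proj M x) v = 0" by auto
qed

lemma bounded_clinear_orth_proj:
  assumes M: "csubspace M" "closed M"
  shows "bounded_clinear (orth_proj M)"
proof (rule bounded_clinearI[where B = 1])
  fix x y :: L2 and c :: complex
  note P = orth_proj[OF M]
  show "orth_proj M (x + y) = orth_proj M x + orth_proj M y"
  proof (rule orth_proj_eqI[OF M(1)])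
    show "orth_proj M x + orth_proj M y \<in> M" using M P by (auto simp: csubspace_def)
    show "cinner (x + y - (orth_proj M x + orth_proj M y)) v = 0" if "v \<in> M" for v
      using P(2)[OF that, of x] P(2)[OF that, of y] by (simp add: cinner_linear)
  qed
  show "orth_proj M (c *\<^sub>C x) = c *\<^sub>C orth_proj M x"
  proof (rule orth_proj_eqI[OF M(1)])
    show "c *\<^sub>C orth_proj M x \<in> M" using M P by (auto simp: csubspace_def)
    show "cinner (c *\<^sub>C x - c *\<^sub>C orth_proj M x) v = 0" if "v \<in> M" for v
      using P(2)[OF that, of x] by (simp add: cinner_scaleC_left flip: scaleC_diff_right)
  qed
  have "(norm x)\<^sup>2 = (norm (orth_proj M x))\<^sup>2 + (norm (x - orth_proj M x))\<^sup>2"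
  proof -
    have "inner (x - orth_proj M x) (orth_proj M x) = 0"
      by (simp add: inner_L2_def P)
    then show ?thesis unfolding power2_norm_eq_inner by (simp add: inner_diff inner_commute)
  qed
  then have "(norm (orth_proj M x))\<^sup>2 \<le> (norm x)\<^sup>2" by simp
  then have "norm (orth_proj M x) \<le> norm x" by (rule power2_le_imp_le) simp
  then show "norm (orth_proj M x) \<le> 1 * norm x" by simp
qed

text \<open>The representing vector is a multiple of the residual \<open>b\<close> of some vector outside the kernel, because
  the kernel has codimension one and \<open>b\<close> is orthogonal to it.\<close>

theorem riesz_representation:
  assumes add: "\<And>x y. l (x + y) = l x + l y" and sc: "\<And>c x. l (c *\<^sub>C x) = c * l x"
    and bd: "\<And>x::L2. norm (l x) \<le> B * norm x"
  shows "\<exists>k. \<forall>x. l x = cinner x k"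
proof (cases "\<forall>x. l x = 0")
  case True
  then show ?thesis by (intro exI[of _ 0]) simp
next
  case False
  then obtain a where a: "l a \<noteq> 0" by blast
  have lin: "bounded_linear l"
    by (rule bounded_linear_intro[where K = B])
       (auto simp: add sc bd scaleR_L2_def scaleR_conv_of_real mult.commute[of _ B])
  define M where "M = {x. l x = 0}"
  have l0: "l 0 = 0" using sc[of 0 0] by simp
  have "csubspace M" by (auto simp: M_def csubspace_def add sc l0)
  moreover have "closed M"
    unfolding M_def using lin by (intro closed_Collect_eq linear_continuous_on) auto
  ultimately obtain p where p: "l p = 0" "\<And>v. l v = 0 \<Longrightarrow> cinner (a - p) v = 0"
    using projection_theorem[of M a] by (auto simp: M_def)
  define b where "b = a - p"
  have b: "cinner v b = 0" if "l v = 0" for v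
    using p(2)[OF that] cinner_commute[of v b] by (simp add: b_def)
  have lb: "l b \<noteq> 0" using add[of b p] a p by (simp add: b_def)
  then have b0: "b \<noteq> 0" using l0 by auto
  show ?thesis
  proof (intro exI allI)
    fix x
    have "l (x + (- (l x / l b)) *\<^sub>C b) = 0" using lb by (simp only: add sc) simp
    from b[OF this] have "cinner x b = (l x / l b) * cinner b b"
      by (simp add: cinner_linear)
    then show "l x = cinner x (cnj (l b / cinner b b) *\<^sub>C b)"
      using lb b0 by (simp add: cinner_scaleC_right cinner_self_eq_0)
  qed
qed

section \<open>Fourier coefficients and the Hardy projection\<close>

definition zpow :: "int \<Rightarrow> L2" where
  "zpow n = class_L2 (\<lambda>z. z powi n)"

lemma square_integrable_powi [simp]: "square_integrable (\<lambda>z. z powi n)"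
  by (simp add: square_integrable_Linf)

lemma unit_circle_cnj: "norm z = 1 \<Longrightarrow> cnj z = inverse z"
  using inverse_unique[of z "cnj z"] by (simp add: complex_norm_square[symmetric])

lemma unit_circle_nonzero: "norm (z::complex) = 1 \<Longrightarrow> z \<noteq> 0"
  by auto

lemma cnj_powi: "cnj (z powi n) = cnj z powi n"
  by (simp add: power_int_def)

lemma fourier_coeff_zpow: "fourier_coeff f n = cinner f (zpow n)"
  by (simp add: fourier_coeff_def zpow_def)

lemma class_L2_cnj: "class_L2 cnj = zpow (-1)"
  unfolding zpow_def
  by (rule class_L2_cong) (auto simp: square_integrable_Linf unit_circle_cnj power_int_minus)

lemma class_L2_one: "class_L2 (\<lambda>_. 1) = zpow 0"
  by (simp add: zpow_def)

lemma class_L2_Linf: "\<phi> \<in> Linf \<Longrightarrow> class_L2 \<phi> = mult_L2 \<phi> (zpow 0)"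
  using mult_L2_class[OF _ square_integrable_powi[of 0]] by (simp add: zpow_def)

lemma mult_z_zpow [simp]: "mult_L2 (\<lambda>z. z) (zpow n) = zpow (n + 1)"
  unfolding zpow_def mult_L2_class[OF Linf_id square_integrable_powi]
  by (rule class_L2_cong)
     (auto simp: square_integrable_mult unit_circle_nonzero power_int_add)

lemma mult_cnj_zpow [simp]: "mult_L2 cnj (zpow n) = zpow (n - 1)"
  unfolding zpow_def mult_L2_class[OF Linf_cnj_id square_integrable_powi]
  by (rule class_L2_cong)
     (auto simp: square_integrable_mult unit_circle_nonzero unit_circle_cnj power_int_diff field_simps)

lemma mult_z_cnj_cancel [simp]:
  "mult_L2 (\<lambda>z. z) (mult_L2 cnj x) = x" "mult_L2 cnj (mult_L2 (\<lambda>z. z) x) = x"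
proof -
  have "AE z in circle. norm z = 1" using AE_circle_sphere by simp
  from mult_L2_cnj_cancel[OF Linf_id this, of x]
  show "mult_L2 (\<lambda>z. z) (mult_L2 cnj x) = x" "mult_L2 cnj (mult_L2 (\<lambda>z. z) x) = x"
    by simp_all
qed

lemma cinner_zpow: "cinner (zpow m) (zpow n) = (if m = n then 1 else 0)"
proof -
  have "cinner (zpow m) (zpow n) = integral\<^sup>L circle (\<lambda>z. z powi m * cnj (z powi n))"
    by (simp add: zpow_def cinner_class)
  also have "\<dots> = integral\<^sup>L circle (\<lambda>z. z powi (m - n))"
    by (rule Bochner_Integration.integral_cong)
       (auto simp: cnj_powi unit_circle_cnj unit_circle_nonzero power_int_diff power_int_inverse divide_inverse)
  finally show ?thesis by (simp add: integral_circle_powi)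
qed

theorem fourier_uniqueness:
  assumes "\<And>n. cinner x (zpow n) = 0"
  shows "x = 0"
proof -
  obtain f where f: "square_integrable f" "x = class_L2 f" by (rule L2_cases)
  have "integrable circle f"
    using integrable_mult_cnj[OF f(1) square_integrable_powi[of 0]] by simp
  moreover have "integral\<^sup>L circle (\<lambda>z. f z * z powi n) = 0" for n
  proof -
    have "integral\<^sup>L circle (\<lambda>z. f z * z powi n) = integral\<^sup>L circle (\<lambda>z. f z * cnj (z powi (- n)))"
      by (rule Bochner_Integration.integral_cong)
         (auto simp: cnj_powi unit_circle_cnj power_int_minus power_int_inverse)
    also have "\<dots> = cinner x (zpow (- n))"
      by (simp add: f zpow_def cinner_class)
    finally show ?thesis using assms by simp
  qed
  ultimately have "AE z in circle. f z = 0" by (rule fourier_uniqueness_integrable)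
  then have "class_L2 f = class_L2 (\<lambda>_. 0)"
    using f by (subst class_L2_eq_iff) auto
  also have "\<dots> = 0" by transfer (simp add: L2_rel_def)
  finally show ?thesis using f by simp
qed

lemma H2_iff: "f \<in> H2 \<longleftrightarrow> (\<forall>n<0. cinner f (zpow n) = 0)"
  by (simp add: H2_def fourier_coeff_zpow)

lemma csubspace_H2: "csubspace H2"
  by (auto simp: csubspace_def H2_iff cinner_linear)

lemma closed_H2: "closed H2"
proof -
  have "H2 = (\<Inter>n\<in>{..<0}. {f. cinner f (zpow n) = 0})" by (auto simp: H2_iff)
  also have "closed \<dots>"
    by (intro closed_INT ballI closed_Collect_eq continuous_intros)
  finally show ?thesis .
qed

lemma zpow_H2: "n \<ge> 0 \<Longrightarrow> zpow n \<in> H2"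
  by (auto simp: H2_iff cinner_zpow)

lemma hardy_proj_H2 [simp]: "hardy_proj x \<in> H2"
  unfolding hardy_proj_def by (rule orth_proj[OF csubspace_H2 closed_H2])

lemma hardy_proj_orth: "v \<in> H2 \<Longrightarrow> cinner (x - hardy_proj x) v = 0"
  unfolding hardy_proj_def by (rule orth_proj[OF csubspace_H2 closed_H2])

lemma bounded_clinear_hardy_proj: "bounded_clinear hardy_proj"
  unfolding hardy_proj_def by (rule bounded_clinear_orth_proj[OF csubspace_H2 closed_H2])

lemma cinner_hardy_proj: "cinner (hardy_proj x) y = cinner x (hardy_proj y)"
proof -
  have "cinner (x - hardy_proj x) (hardy_proj y) = 0" "cinner (y - hardy_proj y) (hardy_proj x) = 0"
    by (simp_all add: hardy_proj_orth)
  then show ?thesis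
    by (metis cinner_commute cinner_diff_left right_minus_eq)
qed

lemma hardy_proj_zpow_nonneg_cinner: "n \<ge> 0 \<Longrightarrow> cinner (hardy_proj x) (zpow n) = cinner x (zpow n)"
  using hardy_proj_orth[OF zpow_H2, of n x] by (simp add: cinner_diff_left)

text \<open>By uniqueness of Fourier coefficients, the nonnegative powers span a dense subspace of the
  Hardy space, so they suffice to test orthogonality to it.\<close>

lemma hardy_proj_eqI:
  assumes "p \<in> H2" "\<And>n. n \<ge> 0 \<Longrightarrow> cinner x (zpow n) = cinner p (zpow n)"
  shows "hardy_proj x = p"
proof -
  have "hardy_proj x - p \<in> H2"
    using assms csubspace_diff[OF csubspace_H2] by simp
  then have "cinner (hardy_proj x - p) (zpow n) = 0" for n
    using assms(2)[of n] hardy_proj_zpow_nonneg_cinner[of n x]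
    by (cases "n < 0") (auto simp: H2_iff cinner_diff_left)
  then show ?thesis using fourier_uniqueness[of "hardy_proj x - p"] by simp
qed

lemma hardy_proj_H2_id: "x \<in> H2 \<Longrightarrow> hardy_proj x = x"
  by (rule hardy_proj_eqI) auto

lemma hardy_proj_eq_0: "(\<And>n. n \<ge> 0 \<Longrightarrow> cinner x (zpow n) = 0) \<Longrightarrow> hardy_proj x = 0"
  using csubspace_H2 by (intro hardy_proj_eqI) (auto simp: csubspace_def)

text \<open>Multiplication by \<open>z\<close> moves exactly one negative Fourier coefficient, the one of index \<open>-1\<close>,
  into the Hardy space.\<close>

lemma hardy_proj_mult_z:
  "hardy_proj (mult_L2 (\<lambda>z. z) x) = mult_L2 (\<lambda>z. z) (hardy_proj x) + cinner x (zpow (-1)) *\<^sub>C zpow 0"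
proof (rule hardy_proj_eqI)
  have c: "cinner (mult_L2 (\<lambda>z. z) y) (zpow n) = cinner y (zpow (n - 1))" for y n
    by (simp add: cinner_mult_L2_left)
  show "mult_L2 (\<lambda>z. z) (hardy_proj x) + cinner x (zpow (-1)) *\<^sub>C zpow 0 \<in> H2"
    using hardy_proj_H2[of x] by (auto simp: H2_iff cinner_linear c cinner_zpow)
  have neg: "cinner (hardy_proj x) (zpow (-1)) = 0"
    using hardy_proj_H2[of x] by (simp add: H2_iff)
  show "cinner (mult_L2 (\<lambda>z. z) x) (zpow n) =
      cinner (mult_L2 (\<lambda>z. z) (hardy_proj x) + cinner x (zpow (-1)) *\<^sub>C zpow 0) (zpow n)"
    if "n \<ge> 0" for n
    using that hardy_proj_zpow_nonneg_cinner[of "n - 1" x]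
    by (cases "n = 0") (auto simp: cinner_linear c cinner_zpow neg)
qed

section \<open>Inner functions\<close>

text \<open>On the circle of radius \<open>r\<close> the Taylor series of \<open>\<theta>\<close> converges absolutely and uniformly, so it may be
  integrated term by term. After multiplication by \<open>z powi m\<close> every term is a multiple of a positive
  power of \<open>z\<close>.\<close>

lemma integral_circle_dilation:
  assumes hol: "\<theta> holomorphic_on ball 0 1" and r: "0 < r" "r < 1" and m: "m > 0"
  shows "(\<lambda>z. \<theta> (complex_of_real r * z)) \<in> borel_measurable circle"
    and "integral\<^sup>L circle (\<lambda>z. \<theta> (complex_of_real r * z) * z powi m) = 0"
proof -
  define a where "a n = (deriv ^^ n) \<theta> 0 / fact n" for n
  have sums: "(\<lambda>n. a n * w ^ n) sums \<theta> w" if "w \<in> ball 0 1" for w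
    using holomorphic_power_series[OF hol that] by (simp add: a_def)
  have ball: "complex_of_real r * z \<in> ball 0 1" if "z \<in> sphere 0 1" for z
    using that r by (simp add: norm_mult)
  have "continuous_on (sphere 0 1) (\<lambda>z. \<theta> (complex_of_real r * z))"
    by (rule continuous_on_compose2[OF holomorphic_on_imp_continuous_on[OF hol]])
       (use ball in \<open>auto intro!: continuous_intros\<close>)
  then show meas [measurable]: "(\<lambda>z. \<theta> (complex_of_real r * z)) \<in> borel_measurable circle"
    by (rule borel_measurable_circle_continuous)
  \<comment> \<open>a point of the disk beyond radius \<open>r\<close>, to obtain absolute convergence at radius \<open>r\<close>\<close>
  define w where "w = complex_of_real ((1 + r) / 2)"
  have "norm w = (1 + r) / 2" unfolding w_def norm_of_real using r by simp
  then have w: "w \<in> ball 0 1" "norm (complex_of_real r) < norm w" using r by auto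
  have sm: "summable (\<lambda>n. norm (a n * complex_of_real r ^ n))"
    by (rule powser_insidea[OF sums_summable[OF sums[OF w(1)]] w(2)])
  define B where "B = (\<Sum>n. norm (a n * complex_of_real r ^ n))"
  have "(\<lambda>N. integral\<^sup>L circle (\<lambda>z. (\<Sum>n<N. a n * (complex_of_real r * z) ^ n) * z powi m))
      \<longlonglongrightarrow> integral\<^sup>L circle (\<lambda>z. \<theta> (complex_of_real r * z) * z powi m)"
  proof (rule integral_dominated_convergence[where w = "\<lambda>_. B"])
    show "AE z in circle. (\<lambda>N. (\<Sum>n<N. a n * (complex_of_real r * z) ^ n) * z powi m)
        \<longlonglongrightarrow> \<theta> (complex_of_real r * z) * z powi m"
      using AE_circle_sphere
      by eventually_elim (intro tendsto_intros sums[OF ball, unfolded sums_def])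
    show "AE z in circle. norm ((\<Sum>n<N. a n * (complex_of_real r * z) ^ n) * z powi m) \<le> B" for N
      using AE_circle_sphere
    proof eventually_elim
      case (elim z)
      then have z: "norm z = 1" by simp
      have "norm ((\<Sum>n<N. a n * (complex_of_real r * z) ^ n) * z powi m) =
          norm (\<Sum>n<N. a n * (complex_of_real r * z) ^ n)"
        using z by (simp add: norm_mult norm_power_int)
      also have "\<dots> \<le> (\<Sum>n<N. norm (a n * (complex_of_real r * z) ^ n))"
        by (rule norm_sum)
      also have "\<dots> = (\<Sum>n<N. norm (a n * complex_of_real r ^ n))"
        using z by (simp add: norm_mult norm_power power_mult_distrib)
      also have "\<dots> \<le> B"
        unfolding B_def by (rule sum_le_suminf[OF sm]) auto
      finally show ?case .
    qed
  qed auto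
  moreover have "integral\<^sup>L circle (\<lambda>z. (\<Sum>n<N. a n * (complex_of_real r * z) ^ n) * z powi m) = 0" for N
  proof -
    have "integral\<^sup>L circle (\<lambda>z. (\<Sum>n<N. a n * (complex_of_real r * z) ^ n) * z powi m) =
        integral\<^sup>L circle (\<lambda>z. \<Sum>n<N. (a n * complex_of_real r ^ n) * z powi (int n + m))"
    proof (rule Bochner_Integration.integral_cong)
      fix z assume "z \<in> space circle"
      then have "z \<noteq> 0" by auto
      then show "(\<Sum>n<N. a n * (complex_of_real r * z) ^ n) * z powi m =
          (\<Sum>n<N. (a n * complex_of_real r ^ n) * z powi (int n + m))"
        unfolding sum_distrib_right
        by (intro sum.cong) (auto simp: power_mult_distrib power_int_add)
    qed simp
    also have "\<dots> = (\<Sum>n<N. (a n * complex_of_real r ^ n) * integral\<^sup>L circle (\<lambda>z. z powi (int n + m)))"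
    proof (subst Bochner_Integration.integral_sum)
      show "integrable circle (\<lambda>z. (a n * complex_of_real r ^ n) * z powi (int n + m))" for n
        using integrable_mult_cnj[OF square_integrable_powi[of "int n + m"] square_integrable_powi[of 0]]
        by simp
    qed simp
    also have "\<dots> = 0"
      using m by (intro sum.neutral) (auto simp: integral_circle_powi)
    finally show ?thesis .
  qed
  ultimately show "integral\<^sup>L circle (\<lambda>z. \<theta> (complex_of_real r * z) * z powi m) = 0"
    by (simp add: LIMSEQ_const_iff)
qed

text \<open>The locale collects the shorthands for the operators attached to one inner function: the primed
  letters are the adjoints of the multiplications \<open>T\<close> and \<open>S\<close>, and \<open>t\<close> is \<open>\<theta>\<close> as an element of \<open>L2\<close>.\<close>

locale inner_symbol =
  fixes \<theta> :: "complex \<Rightarrow> complex"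
  assumes inner: "inner_function \<theta>"
begin

lemma unimodular: "AE z in circle. norm (\<theta> z) = 1"
  using inner by (simp add: inner_function_def)

lemma theta_Linf [simp]: "\<theta> \<in> Linf"
proof -
  have "AE z in circle. norm (\<theta> z) \<le> 1"
    using unimodular by eventually_elim simp
  then show ?thesis using inner by (auto simp: inner_function_def Linf_def)
qed

lemma theta_conj_Linf [simp]: "(\<lambda>z. cnj (\<theta> z)) \<in> Linf"
  by (simp add: Linf_cnj)

abbreviation T where "T \<equiv> mult_L2 \<theta>"
abbreviation T' where "T' \<equiv> mult_L2 (\<lambda>z. cnj (\<theta> z))"
abbreviation S where "S \<equiv> mult_L2 (\<lambda>z. z)"
abbreviation S' where "S' \<equiv> mult_L2 cnj"
abbreviation P where "P \<equiv> hardy_proj"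
abbreviation Q where "Q \<equiv> perp_proj \<theta>"
abbreviation U where "U \<equiv> compressed_shift \<theta>"
abbreviation t where "t \<equiv> class_L2 \<theta>"

lemma T_cancel [simp]: "T (T' x) = x" "T' (T x) = x"
  using mult_L2_cnj_cancel[OF theta_Linf unimodular] by auto

lemma T_S [simp]: "T (S x) = S (T x)" "T' (S x) = S (T' x)" "T (S' x) = S' (T x)" "T' (S' x) = S' (T' x)"
  by (simp_all add: mult_L2_commute)

lemma cinner_T: "cinner (T x) y = cinner x (T' y)" "cinner (T' x) y = cinner x (T y)"
  using cinner_mult_L2_left[of \<theta> x y] cinner_mult_L2_left[of "\<lambda>z. cnj (\<theta> z)" x y] by simp_all

lemma cinner_S: "cinner (S x) y = cinner x (S' y)" "cinner (S' x) y = cinner x (S y)"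
  using cinner_mult_L2_left[of "\<lambda>z. z" x y] cinner_mult_L2_left[of cnj x y] by simp_all

lemmas T_linear = bounded_clinear_rules[OF bounded_clinear_mult_L2[OF theta_Linf]]
  bounded_clinear_rules[OF bounded_clinear_mult_L2[OF theta_conj_Linf]]
lemmas S_linear = bounded_clinear_rules[OF bounded_clinear_mult_L2[OF Linf_id]]
  bounded_clinear_rules[OF bounded_clinear_mult_L2[OF Linf_cnj_id]]
lemmas P_linear = bounded_clinear_rules[OF bounded_clinear_hardy_proj]

lemma T_one: "T (zpow 0) = t"
  by (simp add: class_L2_Linf)

text \<open>The boundary function is the radial limit of the dilations of \<open>\<theta>\<close>, whose coefficients of negative
  index vanish; boundedness of \<open>\<theta>\<close> dominates the limit.\<close>

lemma theta_coeff_negative: "n < 0 \<Longrightarrow> cinner t (zpow n) = 0"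
proof -
  assume n: "n < 0"
  have hol: "\<theta> holomorphic_on ball 0 1" and bdd: "bounded (\<theta> ` ball 0 1)"
    and [measurable]: "\<theta> \<in> borel_measurable circle"
    and lim: "AE z in circle. ((\<lambda>r. \<theta> (complex_of_real r * z)) \<longlongrightarrow> \<theta> z) (at_left 1)"
    using inner by (auto simp: inner_function_def)
  obtain B where "\<forall>x\<in>\<theta> ` ball 0 1. norm x \<le> B"
    using bdd bounded_iff by metis
  then have B: "norm (\<theta> z) \<le> B" if "norm z < 1" for z
    using that by simp
  define r where "r k = 1 - inverse (real (Suc (Suc k)))" for k
  have r: "0 < r k" "r k < 1" for k by (auto simp: r_def field_simps)
  have "r \<longlonglongrightarrow> 1"
    unfolding r_def
    using LIMSEQ_Suc[OF LIMSEQ_inverse_real_of_nat] tendsto_diff[OF tendsto_const, of _ 0 _ "1::real"]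
    by fastforce
  then have r_lim: "filterlim r (at_left 1) sequentially"
    using r by (auto simp: filterlim_at intro!: always_eventually less_imp_neq)
  have "(\<lambda>k. integral\<^sup>L circle (\<lambda>z. \<theta> (complex_of_real (r k) * z) * z powi (- n)))
      \<longlonglongrightarrow> integral\<^sup>L circle (\<lambda>z. \<theta> z * z powi (- n))"
  proof (rule integral_dominated_convergence[where w = "\<lambda>_. B"])
    show "AE z in circle. (\<lambda>k. \<theta> (complex_of_real (r k) * z) * z powi (- n)) \<longlonglongrightarrow> \<theta> z * z powi (- n)"
      using lim
    proof eventually_elim
      case (elim z)
      show ?case by (intro tendsto_intros filterlim_compose[OF elim r_lim])
    qed
    show "AE z in circle. norm (\<theta> (complex_of_real (r k) * z) * z powi (- n)) \<le> B" for k
      using AE_circle_sphere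
    proof eventually_elim
      case (elim z)
      then have z: "norm z = 1" by simp
      then have "norm (complex_of_real (r k) * z) < 1" using r[of k] by (simp add: norm_mult)
      from B[OF this] show ?case using z by (simp add: norm_mult norm_power_int)
    qed
    show "(\<lambda>z. \<theta> (complex_of_real (r k) * z) * z powi (- n)) \<in> borel_measurable circle" for k
      by (intro borel_measurable_times integral_circle_dilation(1)[OF hol r, of 1]) auto
  qed auto
  moreover have "integral\<^sup>L circle (\<lambda>z. \<theta> (complex_of_real (r k) * z) * z powi (- n)) = 0" for k
    using n by (intro integral_circle_dilation(2)[OF hol r]) auto
  ultimately have "integral\<^sup>L circle (\<lambda>z. \<theta> z * z powi (- n)) = 0"
    by (simp add: LIMSEQ_const_iff)
  moreover have "integral\<^sup>L circle (\<lambda>z. \<theta> z * cnj (z powi n)) = integral\<^sup>L circle (\<lambda>z. \<theta> z * z powi (- n))"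
    by (rule Bochner_Integration.integral_cong)
       (auto simp: cnj_powi unit_circle_cnj power_int_minus power_int_inverse)
  ultimately show ?thesis
    by (simp add: zpow_def cinner_class square_integrable_Linf)
qed

lemma theta0_eq: "theta0 \<theta> = cinner t (zpow 0)"
  by (simp add: theta0_def fourier_coeff_zpow)

lemma cinner_T_zpow: "cinner (T (zpow m)) (zpow n) = cinner t (zpow (n - m))"
proof -
  have 1: "cinner (T (zpow m)) (zpow n) =
      integral\<^sup>L circle (\<lambda>z. \<theta> z * z powi m * cnj (z powi n))"
    by (simp add: zpow_def mult_L2_class cinner_class square_integrable_mult)
  have "cinner t (zpow (n - m)) = integral\<^sup>L circle (\<lambda>z. \<theta> z * cnj (z powi (n - m)))"
    by (simp add: zpow_def cinner_class square_integrable_Linf)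
  also have "\<dots> = integral\<^sup>L circle (\<lambda>z. \<theta> z * z powi m * cnj (z powi n))"
    by (rule Bochner_Integration.integral_cong)
       (auto simp: cnj_powi unit_circle_cnj power_int_inverse power_int_diff unit_circle_nonzero field_simps)
  finally show ?thesis using 1 by simp
qed

lemma cinner_T'_zpow: "cinner (T' (zpow m)) (zpow n) = cnj (cinner t (zpow (m - n)))"
  unfolding cinner_T using cinner_commute[of "zpow m" "T (zpow n)"] cinner_T_zpow[of n m] by simp

text \<open>Dually, multiplication by \<open>cnj \<theta>\<close> maps the negative powers of \<open>z\<close> to functions without nonnegative
  Fourier coefficients.\<close>

lemma T_H2: "f \<in> H2 \<Longrightarrow> T f \<in> H2"
proof -
  assume f: "f \<in> H2"
  have "cinner (T f) (zpow n) = 0" if n: "n < 0" for n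
  proof -
    have "cinner (T' (zpow n)) (zpow m) = 0" if "m \<ge> 0" for m
      using that n by (simp add: cinner_T'_zpow theta_coeff_negative)
    then have "P (T' (zpow n)) = 0" by (rule hardy_proj_eq_0)
    then have "cinner f (T' (zpow n)) = 0"
      using cinner_hardy_proj[of f "T' (zpow n)"] hardy_proj_H2_id[OF f] by simp
    then show ?thesis by (simp add: cinner_T)
  qed
  then show ?thesis by (simp add: H2_iff)
qed

text \<open>The residual \<open>x - P x\<close> is orthogonal to the Hardy space, in particular to its part \<open>T ` H2\<close>, so \<open>T'\<close>
  maps it to something orthogonal to the Hardy space.\<close>

lemma P_T': "P (T' (P x)) = P (T' x)"
proof (rule hardy_proj_eqI)
  fix n :: int assume "n \<ge> 0"
  then have "cinner (x - P x) (T (zpow n)) = 0"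
    by (intro hardy_proj_orth T_H2 zpow_H2)
  then show "cinner (T' (P x)) (zpow n) = cinner (P (T' x)) (zpow n)"
    using \<open>n \<ge> 0\<close> by (simp add: hardy_proj_zpow_nonneg_cinner cinner_T cinner_diff_left)
qed simp

section \<open>The projection onto the orthogonal complement of the model space\<close>

text \<open>The orthogonal projection onto the model space, complementary to \<open>Q\<close>.\<close>

definition R :: "L2 \<Rightarrow> L2" where
  "R x = P x - T (P (T' x))"

lemma Q_eq: "Q x = x - R x"
  by (simp add: perp_proj_def cohardy_proj_def R_def)

lemma bounded_clinear_R: "bounded_clinear R"
  unfolding R_def
  by (intro bounded_clinear_diff_fun bounded_clinear_hardy_proj bounded_clinear_mult_L2 theta_Linf theta_conj_Linf
      bounded_clinear_compose[of T] bounded_clinear_compose[of P])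

lemma bounded_clinear_Q: "bounded_clinear Q"
  unfolding Q_eq by (intro bounded_clinear_diff_fun bounded_clinear_ident bounded_clinear_R)

lemmas Q_linear = bounded_clinear_rules[OF bounded_clinear_Q]
lemmas R_linear = bounded_clinear_rules[OF bounded_clinear_R]

lemma cinner_R: "cinner (R x) y = cinner x (R y)"
  by (simp add: R_def cinner_linear cinner_hardy_proj cinner_T)

lemma cinner_Q: "cinner (Q x) y = cinner x (Q y)"
  by (simp add: Q_eq cinner_linear cinner_R)

lemma R_H2: "R x \<in> H2"
  unfolding R_def by (intro csubspace_diff[OF csubspace_H2] T_H2 hardy_proj_H2)

lemma R_R: "R (R x) = R x"
proof -
  have "P (T' (R x)) = 0"
    by (simp add: R_def T_linear P_linear P_T' hardy_proj_H2_id)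
  then show ?thesis
    using hardy_proj_H2_id[OF R_H2[of x]] by (simp add: R_def[of "R x"] T_linear)
qed

lemma Q_Q [simp]: "Q (Q x) = Q x"
  by (simp add: Q_eq R_linear R_R)

lemma R_model_space: "R x \<in> model_space \<theta>"
proof -
  have "cinner (R x) (T g) = 0" if "g \<in> H2" for g
  proof -
    have "cinner (R x) (T g) = cinner (T' (R x)) (P g)"
      using that by (simp add: cinner_T hardy_proj_H2_id)
    also have "\<dots> = cinner (P (T' (R x))) g"
      by (simp add: cinner_hardy_proj)
    also have "P (T' (R x)) = 0"
      by (simp add: R_def T_linear P_linear P_T' hardy_proj_H2_id)
    finally show ?thesis by simp
  qed
  then show ?thesis using R_H2[of x] by (auto simp: model_space_def ominus_def)
qed

lemma model_space_R: "x \<in> model_space \<theta> \<Longrightarrow> R x = x"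
proof -
  assume x: "x \<in> model_space \<theta>"
  have "P (T' x) = 0"
  proof (rule hardy_proj_eq_0)
    fix n :: int assume "n \<ge> 0"
    then show "cinner (T' x) (zpow n) = 0"
      using x zpow_H2 by (auto simp: cinner_T model_space_def ominus_def)
  qed
  then show ?thesis
    using x by (simp add: R_def hardy_proj_H2_id model_space_def ominus_def T_linear)
qed

text \<open>The difference \<open>R x\<close> of \<open>x\<close> and \<open>Q x\<close> lies in the model space, so a vector orthogonal to the model space
  is orthogonal to its own \<open>R x\<close>.\<close>

lemma model_perp_iff: "x \<in> model_perp \<theta> \<longleftrightarrow> Q x = x"
proof
  assume "x \<in> model_perp \<theta>"
  then have "cinner x (R x) = 0"
    using R_model_space by (auto simp: model_perp_def ominus_def)
  then have "cinner (R x) (R x) = 0"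
    using cinner_R[of "R x" x] by (simp add: R_R cinner_R)
  then show "Q x = x" by (simp add: Q_eq cinner_self_eq_0)
next
  assume "Q x = x"
  then have "R x = 0" by (simp add: Q_eq)
  then have "cinner x y = 0" if "y \<in> model_space \<theta>" for y
    using cinner_R[of x y] model_space_R[OF that] by simp
  then show "x \<in> model_perp \<theta>" by (simp add: model_perp_def ominus_def)
qed

lemma Q_model_perp [simp]: "Q x \<in> model_perp \<theta>"
  by (simp add: model_perp_iff)

lemma Q_zpow_neg: "n < 0 \<Longrightarrow> Q (zpow n) = zpow n"
proof -
  assume n: "n < 0"
  have "P (zpow n) = 0" using n by (intro hardy_proj_eq_0) (auto simp: cinner_zpow)
  moreover have "P (T' (zpow n)) = 0"
    using n by (intro hardy_proj_eq_0) (simp add: cinner_T'_zpow theta_coeff_negative)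
  ultimately show ?thesis by (simp add: Q_eq R_def T_linear)
qed

lemma Q_T_H2: "f \<in> H2 \<Longrightarrow> Q (T f) = T f"
  by (simp add: Q_eq R_def hardy_proj_H2_id T_H2)

lemma Q_t: "Q t = t"
  using Q_T_H2[OF zpow_H2[of 0]] by (simp add: T_one)

text \<open>The projection of the constant \<open>1\<close> is where \<open>\<theta>\<^sub>0\<close> enters: the only nonnegative Fourier coefficient of
  \<open>cnj \<theta>\<close> is the one of index \<open>0\<close>.\<close>

lemma Q_one: "Q (zpow 0) = cnj (theta0 \<theta>) *\<^sub>C t"
proof -
  have "P (T' (zpow 0)) = cnj (theta0 \<theta>) *\<^sub>C zpow 0"
  proof (rule hardy_proj_eqI)
    show "cnj (theta0 \<theta>) *\<^sub>C zpow 0 \<in> H2"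
      using zpow_H2[of 0] csubspace_H2 by (simp add: csubspace_def)
    show "cinner (T' (zpow 0)) (zpow n) = cinner (cnj (theta0 \<theta>) *\<^sub>C zpow 0) (zpow n)"
      if "n \<ge> 0" for n
      using that by (cases "n = 0")
        (auto simp: cinner_T'_zpow cinner_linear cinner_zpow theta0_eq theta_coeff_negative)
  qed
  then show ?thesis
    by (simp add: Q_eq R_def hardy_proj_H2_id zpow_H2 T_linear T_one)
qed

text \<open>Division by \<open>z\<close> pushes only the constant coefficient of \<open>\<theta>\<close> out of the Hardy space.\<close>

lemma R_T_conj_z: "R (T (zpow (-1))) = S' (t - theta0 \<theta> *\<^sub>C zpow 0)"
proof -
  have "P (T (zpow (-1))) = T (zpow (-1)) - theta0 \<theta> *\<^sub>C zpow (-1)"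
  proof (rule hardy_proj_eqI)
    have "cinner (T (zpow (-1)) - theta0 \<theta> *\<^sub>C zpow (-1)) (zpow n) = 0" if "n < 0" for n
      using that by (cases "n = -1")
        (auto simp: cinner_linear cinner_T_zpow cinner_zpow theta0_eq theta_coeff_negative)
    then show "T (zpow (-1)) - theta0 \<theta> *\<^sub>C zpow (-1) \<in> H2" by (simp add: H2_iff)
  qed (simp add: cinner_linear cinner_zpow)
  moreover have "P (zpow (-1)) = 0" by (intro hardy_proj_eq_0) (auto simp: cinner_zpow)
  moreover have "T (zpow (-1)) = S' t"
    using T_S(3)[of "zpow 0"] by (simp add: T_one)
  ultimately show ?thesis unfolding R_def T_cancel by (simp add: T_linear S_linear)
qed

text \<open>Both Hardy projections in the definition of \<open>R\<close> commute with multiplication by \<open>z\<close> up to the one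
  coefficient that enters the Hardy space; hence two rank one defects.\<close>

lemma R_S: "R (S x) = S (R x) + cinner x (zpow (-1)) *\<^sub>C zpow 0 - cinner x (T (zpow (-1))) *\<^sub>C t"
  by (simp add: R_def hardy_proj_mult_z T_linear S_linear cinner_T T_one)

text \<open>On the complement of the model space \<open>R x\<close> vanishes and the two defects have proportional
  coefficients, so the compressed shift is multiplication by \<open>z\<close> up to a single rank one term.\<close>

lemma compressed_shift_eq:
  assumes "x \<in> model_perp \<theta>"
  shows "U x = S x - cinner x (zpow (-1)) *\<^sub>C (zpow 0 - cnj (theta0 \<theta>) *\<^sub>C t)"
proof -
  have Qx: "Q x = x" using assms by (simp add: model_perp_iff)
  have "Q (T (zpow (-1))) = theta0 \<theta> *\<^sub>C zpow (-1)"
    using T_S(3)[of "zpow 0"] unfolding Q_eq R_T_conj_z by (simp add: S_linear T_one)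
  then have "cinner x (T (zpow (-1))) = cnj (theta0 \<theta>) * cinner x (zpow (-1))"
    using cinner_Q[of x "T (zpow (-1))"] by (simp add: Qx cinner_scaleC_right)
  moreover have "R x = 0" using Qx by (simp add: Q_eq)
  ultimately have "R (S x) = cinner x (zpow (-1)) *\<^sub>C (zpow 0 - cnj (theta0 \<theta>) *\<^sub>C t)"
    by (simp add: R_S S_linear scaleC_diff_right mult.commute)
  then show ?thesis by (simp add: compressed_shift_def Q_eq)
qed

text \<open>On the model space the compression of multiplication by \<open>z\<close> to the complement has rank at most one: the
  image of a vector depends only on its inner product with \<open>\<theta> / z\<close> and lies on the line through \<open>\<theta>\<close>.\<close>

lemma Q_S_R: "Q (S (R x)) = cinner (S x) (t - theta0 \<theta> *\<^sub>C zpow 0) *\<^sub>C t"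
proof -
  have "cinner (R x) (zpow (-1)) = 0" using R_H2[of x] by (simp add: H2_iff)
  then have "Q (S (R x)) = cinner (R x) (T (zpow (-1))) *\<^sub>C t"
    by (simp add: Q_eq R_S[of "R x"] R_R)
  also have "cinner (R x) (T (zpow (-1))) = cinner (S x) (t - theta0 \<theta> *\<^sub>C zpow 0)"
    by (simp add: cinner_R R_T_conj_z cinner_S)
  finally show ?thesis .
qed

lemma Q_S_Q: "Q (S (Q x)) = Q (S x) - cinner (S x) (t - theta0 \<theta> *\<^sub>C zpow 0) *\<^sub>C t"
proof -
  have "Q (S (Q x)) = Q (S x) - Q (S (R x))" by (simp add: Q_eq[of x] S_linear Q_linear)
  then show ?thesis by (simp add: Q_S_R)
qed

section \<open>Bounded operators and adjoints\<close>

text \<open>Precomposition with \<open>Q\<close> makes the results on operators defined on all of \<open>L2\<close> available for operators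
  on the complement of the model space.\<close>

lemma bounded_clinear_extension:
  assumes "bounded_operator_on (model_perp \<theta>) A"
  shows "bounded_clinear (\<lambda>x. A (Q x))"
proof -
  obtain B where B: "\<And>f. f \<in> model_perp \<theta> \<Longrightarrow> norm (A f) \<le> B * norm f"
    using assms unfolding bounded_operator_on_def by blast
  obtain C where C: "\<And>x. norm (Q x) \<le> norm x * C"
    using bounded_linear.bounded[OF bounded_clinear_bounded_linear[OF bounded_clinear_Q]] by blast
  show ?thesis
  proof (rule bounded_clinearI[where B = "\<bar>B\<bar> * C"])
    fix x y c
    show "A (Q (x + y)) = A (Q x) + A (Q y)" "A (Q (c *\<^sub>C x)) = c *\<^sub>C A (Q x)"
      using assms by (simp_all add: bounded_operator_on_def Q_linear)
    have "norm (A (Q x)) \<le> \<bar>B\<bar> * norm (Q x)"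
      using B[of "Q x"] mult_right_mono[OF abs_ge_self[of B] norm_ge_zero[of "Q x"]] by simp
    also have "\<dots> \<le> \<bar>B\<bar> * (norm x * C)"
      by (intro mult_left_mono C) auto
    finally show "norm (A (Q x)) \<le> \<bar>B\<bar> * C * norm x" by (simp add: mult_ac)
  qed
qed

text \<open>This justifies the definite description in the definition of the adjoint. The Riesz representation
  of the functional extended by \<open>Q\<close> may be projected by \<open>Q\<close> again without changing its values.\<close>

lemma adjoint_on:
  assumes A: "bounded_operator_on (model_perp \<theta>) A" and f: "f \<in> model_perp \<theta>"
  shows "cinner (A f) g = cinner f (adjoint_on (model_perp \<theta>) A g)"
proof -
  note ext = bounded_clinear_extension[OF A]
  obtain B where B: "\<And>x. norm (A (Q x)) \<le> norm x * B"
    using bounded_linear.bounded[OF bounded_clinear_bounded_linear[OF ext]] by blast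
  have "\<exists>k. \<forall>x. cinner (A (Q x)) g = cinner x k"
  proof (rule riesz_representation[where B = "B * norm g"])
    show "norm (cinner (A (Q x)) g) \<le> B * norm g * norm x" for x
      using norm_cinner_le[of "A (Q x)" g] mult_right_mono[OF B[of x] norm_ge_zero[of g]]
      by (simp add: mult_ac)
  qed (simp_all add: bounded_clinear_rules[OF ext] cinner_linear)
  then obtain k where k: "\<And>x. cinner (A (Q x)) g = cinner x k" by blast
  have "cinner (A x) g = cinner x (Q k)" if "x \<in> model_perp \<theta>" for x
    using k[of x] cinner_Q[of x k] that by (simp add: model_perp_iff)
  then have ex: "Q k \<in> model_perp \<theta> \<and> (\<forall>f\<in>model_perp \<theta>. cinner (A f) g = cinner f (Q k))" by simp
  have uniq: "l = Q k"
    if "l \<in> model_perp \<theta> \<and> (\<forall>f\<in>model_perp \<theta>. cinner (A f) g = cinner f l)" for l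
  proof -
    have "l - Q k \<in> model_perp \<theta>" using that by (simp add: model_perp_iff Q_linear)
    then have "cinner (l - Q k) l = cinner (l - Q k) (Q k)" using that ex by metis
    then have "cinner (l - Q k) (l - Q k) = 0" by (simp add: cinner_diff_right)
    then show ?thesis by (simp add: cinner_self_eq_0)
  qed
  have "adjoint_on (model_perp \<theta>) A g = Q k"
    unfolding adjoint_on_def using ex uniq by (rule the_equality)
  then show ?thesis using ex f by simp
qed

section \<open>The displacement identity for dual truncated Hankel operators\<close>

lemma bounded_clinear_Hankel:
  assumes "\<phi> \<in> Linf"
  shows "bounded_clinear (dual_truncated_Hankel \<theta> \<phi>)"
  unfolding dual_truncated_Hankel_def
  by (intro bounded_clinear_compose[OF bounded_clinear_Q] bounded_clinear_compose[OF bounded_clinear_flip]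
      bounded_clinear_mult_L2 assms)

lemma bounded_operator_on_Hankel:
  assumes "\<phi> \<in> Linf"
  shows "bounded_operator_on (model_perp \<theta>) (dual_truncated_Hankel \<theta> \<phi>)"
  unfolding bounded_operator_on_def
proof (intro conjI ballI allI)
  note H = bounded_clinear_Hankel[OF assms]
  show "dual_truncated_Hankel \<theta> \<phi> f \<in> model_perp \<theta>" for f
    by (simp add: dual_truncated_Hankel_def)
  show "\<exists>B. \<forall>f\<in>model_perp \<theta>. norm (dual_truncated_Hankel \<theta> \<phi> f) \<le> B * norm f"
    using bounded_linear.bounded[OF bounded_clinear_bounded_linear[OF H]] by (metis mult.commute)
qed (simp_all add: bounded_clinear_rules[OF bounded_clinear_Hankel[OF assms]])

lemma flip_S': "flip (S' x) = S (flip x)"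
  by (simp add: flip_mult_L2)

lemma flip_S: "flip (S x) = S' (flip x)"
  by (simp add: flip_mult_L2)

text \<open>The flip turns multiplication by \<open>z\<close> into multiplication by \<open>cnj z\<close>, which cancels a second
  multiplication by \<open>z\<close>. Without the compressions the Hankel operator would therefore be unchanged by
  composing with the shift on both sides. What remains is the defect \<open>w\<close> of the inner shift and the
  defect of the outer one, which is the functional \<open>u\<close> times \<open>\<theta>\<close>.\<close>

lemma Hankel_displacement:
  assumes \<phi>: "\<phi> \<in> Linf" and h: "h \<in> model_perp \<theta>"
  defines "u \<equiv> t - theta0 \<theta> *\<^sub>C zpow 0" and "w \<equiv> zpow 0 - cnj (theta0 \<theta>) *\<^sub>C t"
  defines "Y \<equiv> flip (S' (mult_L2 \<phi> w))"
  shows "dual_truncated_Hankel \<theta> \<phi> h - U (dual_truncated_Hankel \<theta> \<phi> (U h)) =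
    cinner (flip (mult_L2 \<phi> h)) u *\<^sub>C t + cinner h (zpow (-1)) *\<^sub>C (Q Y - cinner Y u *\<^sub>C t)"
proof -
  note M = bounded_clinear_rules[OF bounded_clinear_mult_L2[OF \<phi>]]
  note J = bounded_clinear_rules[OF bounded_clinear_flip]
  define c where "c = cinner h (zpow (-1))"
  define g where "g = flip (mult_L2 \<phi> h)"
  have Uh: "U h = S h - c *\<^sub>C w" unfolding c_def w_def by (rule compressed_shift_eq[OF h])
  have JMS: "flip (mult_L2 \<phi> (S h)) = S' g"
    using \<phi> by (simp add: g_def mult_L2_commute[of \<phi>] flip_S)
  have Y: "S (flip (mult_L2 \<phi> w)) = Y" by (simp add: Y_def flip_S')
  have "U (dual_truncated_Hankel \<theta> \<phi> (U h)) = Q (S (dual_truncated_Hankel \<theta> \<phi> (U h)))"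
    by (rule compressed_shift_def)
  also have "\<dots> = Q (S (Q (S' g))) - c *\<^sub>C Q (S (Q (flip (mult_L2 \<phi> w))))"
    by (simp add: dual_truncated_Hankel_def Uh M J JMS Q_linear S_linear)
  also have "\<dots> = Q g - cinner g u *\<^sub>C t - c *\<^sub>C (Q Y - cinner Y u *\<^sub>C t)"
    unfolding Q_S_Q Y u_def[symmetric] by simp
  finally show ?thesis
    by (simp add: dual_truncated_Hankel_def c_def g_def)
qed

text \<open>This rewrites the vectors of the previous identity in terms of the symbol. The two multiples of
  \<open>cinner h (zpow (-1)) *\<^sub>C t\<close> agree because \<open>delta\<close> is exactly what the term \<open>- cnj \<theta>\<^sub>0 * \<theta>\<close> of \<open>w\<close>
  contributes.\<close>

lemma Hankel_identity:
  assumes \<phi>: "\<phi> \<in> Linf" and h: "h \<in> model_perp \<theta>"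
  shows "dual_truncated_Hankel \<theta> \<phi> h
      - compressed_shift \<theta> (dual_truncated_Hankel \<theta> \<phi> (compressed_shift \<theta> h)) =
        (class_L2 \<theta> \<otimes>
          (perp_proj \<theta> (flip (class_L2 (alpha \<theta> (star \<phi>))))
           - cinner (perp_proj \<theta> (flip (class_L2 (alpha \<theta> (star \<phi>))))) (class_L2 cnj) *\<^sub>C class_L2 cnj)) h
        + ((perp_proj \<theta> (flip (class_L2 (\<lambda>z. \<phi> z * cnj z * (1 - cnj (theta0 \<theta>) * \<theta> z))))
            + delta \<theta> \<phi> *\<^sub>C class_L2 \<theta>) \<otimes> class_L2 cnj) h"
proof -
  define u where "u = t - theta0 \<theta> *\<^sub>C zpow 0"
  define w where "w = zpow 0 - cnj (theta0 \<theta>) *\<^sub>C t"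
  define Y where "Y = flip (S' (mult_L2 \<phi> w))"
  define c where "c = cinner h (zpow (-1))"
  note M = bounded_clinear_rules[OF bounded_clinear_mult_L2[OF \<phi>]]
  have star: "star \<phi> \<in> Linf"
    unfolding star_def[abs_def] using Linf_cnj[OF Linf_flip[OF \<phi>]] .
  have sq1: "square_integrable (\<lambda>_. 1)" and sqt: "square_integrable \<theta>"
    by (simp_all add: square_integrable_Linf)
  have u: "u = class_L2 (\<lambda>z. \<theta> z - theta0 \<theta> * 1)"
    unfolding u_def class_L2_one[symmetric]
    by (simp only: class_L2_diff class_L2_scaleC sq1 sqt square_integrable_scale)
  have w: "w = class_L2 (\<lambda>z. 1 - cnj (theta0 \<theta>) * \<theta> z)"
    unfolding w_def class_L2_one[symmetric]
    by (simp only: class_L2_diff class_L2_scaleC sq1 sqt square_integrable_scale)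
  have squ: "square_integrable (\<lambda>z. \<theta> z - theta0 \<theta> * 1)"
    and sqw: "square_integrable (\<lambda>z. 1 - cnj (theta0 \<theta>) * \<theta> z)"
    by (intro square_integrable_diff square_integrable_scale sq1 sqt)+
  have alpha: "class_L2 (alpha \<theta> (star \<phi>)) = mult_L2 (star \<phi>) u"
    unfolding u mult_L2_class[OF star squ] by (simp add: alpha_def[abs_def])
  have Y': "flip (class_L2 (\<lambda>z. \<phi> z * cnj z * (1 - cnj (theta0 \<theta>) * \<theta> z))) = Y"
    unfolding Y_def w
    by (simp only: mult_L2_class \<phi> Linf_cnj_id sqw square_integrable_mult) (simp add: mult_ac)
  \<comment> \<open>multiplication by \<open>star \<phi>\<close> followed by the flip is adjoint to multiplication by \<open>\<phi>\<close> followed by the flip\<close>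
  have first: "cinner h (Q (flip (mult_L2 (star \<phi>) u))) = cinner (flip (mult_L2 \<phi> h)) u"
  proof -
    have "cinner h (Q (flip (mult_L2 (star \<phi>) u))) = cinner h (flip (mult_L2 (star \<phi>) u))"
      using h cinner_Q[of h] by (simp add: model_perp_iff)
    also have "\<dots> = cinner (mult_L2 (\<lambda>z. \<phi> (cnj z)) (flip h)) u"
      by (simp add: cinner_flip_left[symmetric] cinner_mult_L2_right star star_def)
    finally show ?thesis by (simp add: flip_mult_L2 \<phi>)
  qed
  have delta: "delta \<theta> \<phi> = cnj (theta0 \<theta>) * cinner (S' (mult_L2 \<phi> t)) (flip u)"
  proof -
    have "square_integrable (\<lambda>z. \<theta> (cnj z) - theta0 \<theta> * 1)"
      using square_integrable_cnj_arg[OF squ] by simp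
    note sq = square_integrable_mult[OF Linf_cnj_id square_integrable_mult[OF \<phi> sqt]] this
    have F: "flip u = class_L2 (\<lambda>z. \<theta> (cnj z) - theta0 \<theta> * 1)"
      unfolding u by (rule flip_class[OF squ])
    have "cinner (S' (mult_L2 \<phi> t)) (flip u) =
        integral\<^sup>L circle (\<lambda>z. (cnj z * (\<phi> z * \<theta> z)) * cnj (\<theta> (cnj z) - theta0 \<theta> * 1))"
      unfolding F
      by (simp only: mult_L2_class \<phi> Linf_cnj_id sqt square_integrable_mult cinner_class[OF sq])
    also have "\<dots> = integral\<^sup>L circle (\<lambda>z. \<phi> z * \<theta> z * (star \<theta> z - cnj (theta0 \<theta>)) * cnj z)"
      by (rule Bochner_Integration.integral_cong) (simp_all add: star_def mult_ac)
    also have "\<dots> = cinner (class_L2 (\<lambda>z. \<phi> z * \<theta> z * (star \<theta> z - cnj (theta0 \<theta>)))) (class_L2 (\<lambda>z. z))"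
    proof (rule cinner_class[symmetric])
      have "(\<lambda>z. star \<theta> z + (- cnj (theta0 \<theta>))) \<in> Linf"
        unfolding star_def using Linf_add[OF Linf_cnj[OF Linf_flip[OF theta_Linf]] Linf_const] .
      then show "square_integrable (\<lambda>z. \<phi> z * \<theta> z * (star \<theta> z - cnj (theta0 \<theta>)))"
        using \<phi> by (intro square_integrable_Linf Linf_mult) auto
    qed (simp add: square_integrable_Linf)
    finally show ?thesis by (simp add: delta_def)
  qed
  have second: "cnj (cinner (Q (flip (mult_L2 (star \<phi>) u))) (zpow (-1))) - delta \<theta> \<phi> = cinner Y u"
  proof -
    have "cnj (cinner (Q (flip (mult_L2 (star \<phi>) u))) (zpow (-1))) =
        cinner (zpow (-1)) (flip (mult_L2 (star \<phi>) u))"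
      using cinner_commute[of "zpow (-1)" "flip (mult_L2 (star \<phi>) u)"] by (simp add: cinner_Q Q_zpow_neg)
    also have "\<dots> = cinner (mult_L2 \<phi> (zpow (-1))) (flip u)"
      by (simp add: flip_mult_L2 star star_def cinner_mult_L2_right Linf_cnj \<phi>)
    also have "mult_L2 \<phi> (zpow (-1)) = S' (mult_L2 \<phi> (zpow 0))"
      by (simp add: mult_L2_commute[OF Linf_cnj_id \<phi>])
    finally show ?thesis
      unfolding delta Y_def cinner_flip_left w_def
      by (simp add: M S_linear cinner_linear)
  qed
  have "dual_truncated_Hankel \<theta> \<phi> h - U (dual_truncated_Hankel \<theta> \<phi> (U h)) =
      cinner (flip (mult_L2 \<phi> h)) u *\<^sub>C t + c *\<^sub>C (Q Y - cinner Y u *\<^sub>C t)"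
    unfolding u_def w_def Y_def c_def by (rule Hankel_displacement[OF \<phi> h])
  then show ?thesis
    unfolding alpha Y' class_L2_cnj rank_one_def cinner_diff_right first cinner_scaleC_right c_def[symmetric]
      second[symmetric]
    by (simp add: scaleC_add_right scaleC_diff_right scaleC_diff_left algebra_simps)
qed

section \<open>Rigidity\<close>

text \<open>The case distinction of the theorem has its source here. By the formula for \<open>U\<close>, a kernel vector is
  determined by its coefficient of index \<open>-1\<close>; projecting the resulting expression by \<open>Q\<close> shows that
  this coefficient vanishes unless \<open>\<theta>\<^sub>0 = 0\<close>. For \<open>\<theta>\<^sub>0 = 0\<close> the kernel is spanned by \<open>cnj z\<close>.\<close>

lemma compressed_shift_injective:
  assumes h: "h \<in> model_perp \<theta>" and U0: "U h = 0"
    and c: "theta0 \<theta> \<noteq> 0 \<or> cinner h (zpow (-1)) = 0"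
  shows "h = 0"
proof -
  define c where "c = cinner h (zpow (-1))"
  have "S h = c *\<^sub>C (zpow 0 - cnj (theta0 \<theta>) *\<^sub>C t)"
    using U0 compressed_shift_eq[OF h] by (simp add: c_def)
  then have "S' (S h) = S' (c *\<^sub>C (zpow 0 - cnj (theta0 \<theta>) *\<^sub>C t))" by simp
  then have h_eq: "h = c *\<^sub>C (zpow (-1) - cnj (theta0 \<theta>) *\<^sub>C T (zpow (-1)))"
    using T_S(3)[of "zpow 0"] by (simp add: S_linear T_one)
  have QT: "Q (T (zpow (-1))) = theta0 \<theta> *\<^sub>C zpow (-1)"
    using T_S(3)[of "zpow 0"] unfolding Q_eq R_T_conj_z by (simp add: S_linear T_one)
  have "h = Q h" using h by (simp add: model_perp_iff)
  also have "\<dots> = c *\<^sub>C (1 - cnj (theta0 \<theta>) * theta0 \<theta>) *\<^sub>C zpow (-1)"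
    by (subst h_eq) (simp add: Q_linear QT Q_zpow_neg scaleC_diff_left)
  finally have "cinner h (zpow (-1)) =
      cinner (c *\<^sub>C (1 - cnj (theta0 \<theta>) * theta0 \<theta>) *\<^sub>C zpow (-1)) (zpow (-1))"
    by (rule arg_cong)
  then have "c = c * (1 - cnj (theta0 \<theta>) * theta0 \<theta>)"
    by (simp add: c_def[symmetric] cinner_scaleC_left cinner_zpow)
  then have "c * (cnj (theta0 \<theta>) * theta0 \<theta>) = 0" by (simp add: algebra_simps)
  then have "c = 0" using c by (auto simp: c_def)
  then show ?thesis using h_eq by simp
qed

text \<open>The shift \<open>U\<close> maps \<open>\<theta> * z ^ n\<close> to \<open>\<theta> * z ^ (n + 1)\<close>, so \<open>U\<close> annihilates the image under \<open>D\<close> of the latter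
  as soon as \<open>D\<close> annihilates the former; injectivity of \<open>U\<close> on the range of \<open>D\<close> carries the zeros of
  \<open>D\<close> up from \<open>\<theta>\<close>. In the other direction \<open>U\<close> maps \<open>cnj z\<close> to a multiple of \<open>\<theta>\<close> and lowers every higher
  power of \<open>cnj z\<close> by one, so the relation itself gives the zeros of \<open>D\<close> there. These vectors span a dense
  subspace of the complement of the model space.\<close>

lemma rigidity:
  assumes D: "bounded_clinear (\<lambda>x. D (Q x))"
    and range: "\<And>x. x \<in> model_perp \<theta> \<Longrightarrow> D x \<in> model_perp \<theta>"
    and inv: "\<And>x. x \<in> model_perp \<theta> \<Longrightarrow> D x = U (D (U x))"
    and Dt: "D t = 0"
    and c: "theta0 \<theta> \<noteq> 0 \<or> (\<forall>x\<in>model_perp \<theta>. cinner (D x) (zpow (-1)) = 0)"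
    and f: "f \<in> model_perp \<theta>"
  shows "D f = 0"
proof -
  define N where "N = {x. D (Q x) = 0}"
  have N: "csubspace N" "closed N"
    unfolding N_def by (rule bounded_clinear_kernel[OF D])+
  have U0: "U 0 = 0" by (simp add: compressed_shift_def S_linear Q_linear)
  have pos: "T (zpow (int n)) \<in> N" for n
  proof (induction n)
    case 0
    then show ?case using Dt by (simp add: N_def T_one Q_t)
  next
    case (Suc n)
    have V: "Q (T (zpow (int n))) = T (zpow (int n))" "Q (T (zpow (int (Suc n)))) = T (zpow (int (Suc n)))"
      by (intro Q_T_H2 zpow_H2; simp)+
    have "T (zpow (int (Suc n))) = S (T (zpow (int n)))"
      using T_S(1)[of "zpow (int n)"] by (simp add: add.commute)
    then have "U (T (zpow (int n))) = T (zpow (int (Suc n)))"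
      using V(2) by (simp add: compressed_shift_def)
    then have "U (D (T (zpow (int (Suc n))))) = 0"
      using Suc inv[of "T (zpow (int n))"] V(1) by (simp add: N_def model_perp_iff)
    moreover have "T (zpow (int (Suc n))) \<in> model_perp \<theta>" using V(2) by (simp add: model_perp_iff)
    ultimately have "D (T (zpow (int (Suc n)))) = 0"
      using compressed_shift_injective[of "D (T (zpow (int (Suc n))))"] range c by blast
    then show ?case using V(2) by (simp add: N_def)
  qed
  have neg: "zpow (- int (Suc n)) \<in> N" for n
  proof (induction n)
    case 0
    have V: "Q (zpow (-1)) = zpow (-1)" by (simp add: Q_zpow_neg)
    have "U (zpow (-1)) = Q (cnj (theta0 \<theta>) *\<^sub>C t)"
      using Q_t by (simp add: compressed_shift_def Q_one Q_linear)
    moreover have "D (Q (cnj (theta0 \<theta>) *\<^sub>C t)) = 0"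
      using bounded_clinear_scaleC[OF D, of "cnj (theta0 \<theta>)" t] Dt by (simp add: Q_t)
    ultimately have "D (zpow (-1)) = 0"
      using inv[of "zpow (-1)"] V U0 by (simp add: model_perp_iff)
    then show ?case using V by (simp add: N_def)
  next
    case (Suc n)
    have V: "Q (zpow (- int (Suc n))) = zpow (- int (Suc n))"
      "Q (zpow (- int (Suc (Suc n)))) = zpow (- int (Suc (Suc n)))"
      by (simp_all add: Q_zpow_neg)
    have "S (zpow (- int (Suc (Suc n)))) = zpow (- int (Suc n))"
      by simp
    then have "U (zpow (- int (Suc (Suc n)))) = zpow (- int (Suc n))"
      using V(1) by (simp only: compressed_shift_def)
    then have "D (zpow (- int (Suc (Suc n)))) = 0"
      using inv[of "zpow (- int (Suc (Suc n)))"] V Suc U0 by (simp add: model_perp_iff N_def)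
    then show ?case using V by (simp add: N_def)
  qed
  \<comment> \<open>density: the part of \<open>f\<close> orthogonal to the kernel of \<open>D\<close> has no component in either half of the complement\<close>
  obtain p where p: "p \<in> N" "\<And>v. v \<in> N \<Longrightarrow> cinner (f - p) v = 0"
    using projection_theorem[OF N] by blast
  have "f - p \<in> H2"
    unfolding H2_iff
  proof (intro allI impI)
    fix n :: int assume "n < 0"
    then have "n = - int (Suc (nat (- n - 1)))" by simp
    then show "cinner (f - p) (zpow n) = 0" using p(2)[OF neg] by metis
  qed
  moreover have "P (T' (f - p)) = 0"
  proof (rule hardy_proj_eq_0)
    fix n :: int assume "n \<ge> 0"
    then show "cinner (T' (f - p)) (zpow n) = 0"
      using p(2)[OF pos[of "nat n"]] by (simp add: cinner_T)
  qed
  ultimately have "Q (f - p) = 0"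
    by (simp add: Q_eq R_def hardy_proj_H2_id T_linear)
  then have "D (Q f) = D (Q p)" by (simp add: Q_linear)
  then show ?thesis using p(1) f by (simp add: N_def model_perp_iff)
qed

end

theorem theorem3p7:
  fixes \<theta> \<phi> :: "complex \<Rightarrow> complex" and A :: "L2 \<Rightarrow> L2"
  assumes "inner_function \<theta>"
    and "\<phi> \<in> Linf"
    and "bounded_operator_on (model_perp \<theta>) A"
    and "\<And>h. h \<in> model_perp \<theta> \<Longrightarrow>
      A h - compressed_shift \<theta> (A (compressed_shift \<theta> h)) =
        (class_L2 \<theta> \<otimes>
          (perp_proj \<theta> (flip (class_L2 (alpha \<theta> (star \<phi>))))
           - cinner (perp_proj \<theta> (flip (class_L2 (alpha \<theta> (star \<phi>))))) (class_L2 cnj) *\<^sub>C class_L2 cnj)) h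
        + ((perp_proj \<theta> (flip (class_L2 (\<lambda>z. \<phi> z * cnj z * (1 - cnj (theta0 \<theta>) * \<theta> z))))
            + delta \<theta> \<phi> *\<^sub>C class_L2 \<theta>) \<otimes> class_L2 cnj) h"
  shows "(theta0 \<theta> \<noteq> 0 \<longrightarrow>
      ((\<forall>h\<in>model_perp \<theta>. A h = dual_truncated_Hankel \<theta> \<phi> h) \<longleftrightarrow>
        A (class_L2 \<theta>) = dual_truncated_Hankel \<theta> \<phi> (class_L2 \<theta>)))
    \<and> (theta0 \<theta> = 0 \<longrightarrow>
      ((\<forall>h\<in>model_perp \<theta>. A h = dual_truncated_Hankel \<theta> \<phi> h) \<longleftrightarrow>
        A (class_L2 \<theta>) = dual_truncated_Hankel \<theta> \<phi> (class_L2 \<theta>) \<and>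
        adjoint_on (model_perp \<theta>) A (class_L2 cnj) =
          adjoint_on (model_perp \<theta>) (dual_truncated_Hankel \<theta> \<phi>) (class_L2 cnj)))"
proof -
  interpret inner_symbol \<theta> by standard (rule assms(1))
  let ?V = "model_perp \<theta>" and ?H = "dual_truncated_Hankel \<theta> \<phi>"
  note A = assms(3)
  note H = bounded_operator_on_Hankel[OF assms(2)]
  define D where "D x = A x - ?H x" for x
  have V_diff: "x - y \<in> ?V" if "x \<in> ?V" "y \<in> ?V" for x y
    using that by (simp add: model_perp_iff Q_linear)
  have range: "D x \<in> ?V" if "x \<in> ?V" for x
    using A H that unfolding D_def bounded_operator_on_def by (intro V_diff) auto
  have D_bounded: "bounded_clinear (\<lambda>x. D (Q x))"
    unfolding D_def by (intro bounded_clinear_diff_fun bounded_clinear_extension A H)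
  have D_inv: "D x = U (D (U x))" if x: "x \<in> ?V" for x
  proof -
    have "A x - U (A (U x)) = ?H x - U (?H (U x))"
      unfolding assms(4)[OF x] Hankel_identity[OF assms(2) x] ..
    then show ?thesis
      by (simp add: D_def compressed_shift_def[of _ "_ - _"] S_linear Q_linear)
         (simp add: compressed_shift_def algebra_simps)
  qed
  have rigid: "A x = ?H x"
    if "A t = ?H t" "theta0 \<theta> \<noteq> 0 \<or> (\<forall>x\<in>?V. cinner (D x) (zpow (-1)) = 0)" "x \<in> ?V" for x
  proof -
    have "D x = 0"
      by (rule rigidity[OF D_bounded range D_inv _ that(2,3)]) (use that(1) in \<open>simp_all add: D_def\<close>)
    then show ?thesis by (simp add: D_def)
  qed
  have "t \<in> ?V" by (simp add: model_perp_iff Q_t)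
  moreover have "cinner (D x) (zpow (-1)) = 0"
    if "adjoint_on ?V A (class_L2 cnj) = adjoint_on ?V ?H (class_L2 cnj)" "x \<in> ?V" for x
    using that adjoint_on[OF A that(2), of "zpow (-1)"] adjoint_on[OF H that(2), of "zpow (-1)"]
    by (simp add: D_def cinner_diff_left class_L2_cnj)
  moreover have "adjoint_on ?V A g = adjoint_on ?V ?H g" if "\<forall>h\<in>?V. A h = ?H h" for g
    using that by (simp add: adjoint_on_def)
  ultimately show ?thesis using rigid by blast
qed

end
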